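(* Let $X$ be a real Lévy process that has jumps of both signs, i.e. its Lévy measure $\Pi$ satisfies $\Pi((0,\infty))>0$ and $\Pi((-\infty,0))>0$. Then for any fixed $x>0$ $$\liminf_{n\to\infty} n\,\mathbb P\big(M>x,\;M^{(n)}\le x\big)>0.$$
   Context: $M=\sup\{X_t:t\in[0,1]\}$ and $M^{(n)}=\max\{X_{i/n}:i=0,\ldots,n\}$ for $n\ge1$, where $X_0=0$. *)

theory Defs
  imports "HOL-Probability.Probability"
begin

definition cadlag :: "(real \<Rightarrow> real) \<Rightarrow> bool" where
  "cadlag f \<longleftrightarrow> (\<forall>t\<ge>0. continuous (at_right t) f) \<and> (\<forall>t>0. \<exists>l. (f \<longlongrightarrow> l) (at_left t))"

definition jump :: "(real \<Rightarrow> real) \<Rightarrow> real \<Rightarrow> real" where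
  "jump f t = f t - Lim (at_left t) f"

text \<open>
  The time index is the half-line of nonnegative reals; the values \<open>X t\<close> for \<open>t < 0\<close> are irrelevant.
\<close>

locale levy_process = prob_space P for P :: "'a measure" +
  fixes X :: "real \<Rightarrow> 'a \<Rightarrow> real"
  assumes measurable_process: "t \<ge> 0 \<Longrightarrow> X t \<in> borel_measurable P"
    and start_zero: "AE \<omega> in P. X 0 \<omega> = 0"
    and indep_increments: "0 \<le> \<tau> 0 \<Longrightarrow> (\<And>i. i < n \<Longrightarrow> \<tau> i \<le> \<tau> (Suc i)) \<Longrightarrow>
      indep_vars (\<lambda>_. borel) (\<lambda>i \<omega>. X (\<tau> (Suc i)) \<omega> - X (\<tau> i) \<omega>) {..<n::nat}"
    and stationary_increments: "0 \<le> s \<Longrightarrow> s \<le> t \<Longrightarrow>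
      distr P borel (\<lambda>\<omega>. X t \<omega> - X s \<omega>) = distr P borel (X (t - s))"
    and cadlag_paths: "AE \<omega> in P. cadlag (\<lambda>t. X t \<omega>)"

text \<open>
  The Levy measure of a Borel set \<open>A\<close> is the expected number of jumps with size in \<open>A\<close>
  per unit of time, where a jump is a nonzero value of \<^const>\<open>jump\<close>.
\<close>

definition levy_measure :: "'a measure \<Rightarrow> (real \<Rightarrow> 'a \<Rightarrow> real) \<Rightarrow> real set \<Rightarrow> ennreal" where
  "levy_measure P X A =
    (\<integral>\<^sup>+\<omega>. emeasure (count_space UNIV)
      {t \<in> {0<..1}. jump (\<lambda>s. X s \<omega>) t \<noteq> 0 \<and> jump (\<lambda>s. X s \<omega>) t \<in> A} \<partial>P)"

definition sup_process :: "(real \<Rightarrow> 'a \<Rightarrow> real) \<Rightarrow> 'a \<Rightarrow> real" where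
  "sup_process X \<omega> = (SUP t\<in>{0..1}. X t \<omega>)"

text \<open>Only \<open>n \<ge> 1\<close> is meaningful.\<close>

definition grid_max :: "(real \<Rightarrow> 'a \<Rightarrow> real) \<Rightarrow> nat \<Rightarrow> 'a \<Rightarrow> real" where
  "grid_max X n \<omega> = Max ((\<lambda>i. X (real i / real n) \<omega>) ` {0..n})"

text \<open>
  As paths are only almost surely cadlag, the event that the supremum exceeds \<open>x\<close> need only be
  measurable up to a null set. Probabilities are therefore taken with respect to the completion
  of \<open>P\<close>, which agrees with \<open>P\<close> on the measurable sets of \<open>P\<close>.
\<close>

definition missed_exceedance_prob ::
    "'a measure \<Rightarrow> (real \<Rightarrow> 'a \<Rightarrow> real) \<Rightarrow> real \<Rightarrow> nat \<Rightarrow> real" where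
  "missed_exceedance_prob P X x n =
    measure (completion P) {\<omega> \<in> space P. sup_process X \<omega> > x \<and> grid_max X n \<omega> \<le> x}"

end

theory Submission imports Defs begin

text \<open>
  A half-grid step of length \<open>1 / (2 n)\<close> lies close to a given point \<open>a \<noteq> 0\<close> of the support of the Levy
  measure with probability at least \<open>c / n\<close>: by Fatou's lemma the expected number of such steps does not
  vanish in the limit. Hence an up-step near \<open>a > 0\<close> directly followed by a down-step near \<open>- b < 0\<close>, both
  inside one cell of the grid, has probability of order \<open>1 / n\<^sup>2\<close>. If the path has stayed below \<open>x\<close>, starts
  the cell at a level \<open>y \<le> x\<close> with \<open>y + a > x\<close> and \<open>y + a - b \<le> x\<close>, and does not climb afterwards, then it
  exceeds \<open>x\<close> on the half-grid only at the midpoint of this cell. These events are disjoint for different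
  cells, so summing over order \<open>n\<close> cells gives a probability of order \<open>1 / n\<close>.

  It remains to reach such a level \<open>y\<close> with positive probability. Walking from \<open>0\<close> by \<open>+ a\<close> and \<open>- b\<close> without
  exceeding \<open>x\<close> always ends with \<open>x - a < y \<le> x - a + b\<close>. Either some reachable level satisfies all
  inequalities strictly, which leaves room for errors; or the walk from every reachable level hits the
  boundary exactly. In the second case the reachable levels form a locally finite set, so the path has
  no small fluctuations at all: it stays constant for a while with positive probability, and \<open>a\<close> and \<open>- b\<close>
  are atoms of the jump distribution, so that the inequalities need not be strict.
\<close>

section \<open>Independence of consecutive path segments\<close>

lemma nonneg_Rats_cases:
  fixes v :: real
  assumes "v \<in> \<rat>" "0 \<le> v"
  obtains p q :: nat where "q > 0" "v = real p / real q"
  using Rats_abs_nat_div_natE[OF assms(1)] assms(2) by (metis abs_of_nonneg gr0I)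

context levy_process
begin

text \<open>Restricting to rational times keeps path events measurable; it loses nothing for cadlag paths.\<close>

definition inc_path :: "real \<Rightarrow> real \<Rightarrow> (real \<Rightarrow> real set) \<Rightarrow> 'a set" where
  "inc_path s T D = {\<omega> \<in> space P. \<forall>v\<in>\<rat> \<inter> {0..T}. X (s + v) \<omega> - X s \<omega> \<in> D v}"

lemma inc_path_sets:
  assumes "0 \<le> s" and D: "\<And>v. D v \<in> sets borel"
  shows "inc_path s T D \<in> sets P"
proof -
  have "inc_path s T D = {\<omega> \<in> space P. \<forall>v\<in>\<rat>. 0 \<le> v \<and> v \<le> T \<longrightarrow> X (s + v) \<omega> - X s \<omega> \<in> D v}"
    unfolding inc_path_def by auto
  also have "\<dots> \<in> sets P"
  proof (rule sets.sets_Collect_countable_All'[OF _ countable_rat])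
    fix v :: real
    show "{\<omega> \<in> space P. 0 \<le> v \<and> v \<le> T \<longrightarrow> X (s + v) \<omega> - X s \<omega> \<in> D v} \<in> sets P"
    proof (cases "0 \<le> v \<and> v \<le> T")
      case True
      then have [measurable]: "X (s + v) \<in> borel_measurable P" "X s \<in> borel_measurable P"
        using assms by (auto intro: measurable_process)
      have "(\<lambda>\<omega>. X (s + v) \<omega> - X s \<omega>) -` D v \<inter> space P \<in> sets P"
        by (rule measurable_sets[OF _ D]) measurable
      then show ?thesis using True by (simp add: vimage_def Int_def conj_commute)
    next
      case False
      then have "{\<omega> \<in> space P. 0 \<le> v \<and> v \<le> T \<longrightarrow> X (s + v) \<omega> - X s \<omega> \<in> D v} = space P" by auto
      then show ?thesis by simp
    qed
  qed
  finally show ?thesis .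
qed

lemma inc_path_mono:
  assumes "T' \<le> T" "\<And>v. 0 \<le> v \<Longrightarrow> v \<le> T' \<Longrightarrow> D v \<subseteq> D' v"
  shows "inc_path s T D \<subseteq> inc_path s T' D'"
  using assms unfolding inc_path_def by force

text \<open>The finite-dimensional counterpart of \<open>inc_path\<close>, to which independence and
  stationarity of finitely many increments apply directly.\<close>

definition grid_path :: "nat \<Rightarrow> real \<Rightarrow> nat \<Rightarrow> (real \<Rightarrow> real set) \<Rightarrow> 'a set" where
  "grid_path M s b D = {\<omega> \<in> space P. \<forall>j\<le>b. X (s + real j / M) \<omega> - X s \<omega> \<in> D (real j / M)}"

definition grid_event :: "nat \<Rightarrow> nat \<Rightarrow> (real \<Rightarrow> real \<Rightarrow> real set) \<Rightarrow> 'a set" where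
  "grid_event M a D =
    {\<omega> \<in> space P. \<forall>k\<le>a. \<forall>j\<le>k. X (real k / M) \<omega> - X (real j / M) \<omega> \<in> D (real j / M) (real k / M)}"

text \<open>Both events are read off the one-step increments on the grid of mesh
  \<open>1 / M\<close>: the first off those with index below \<open>a\<close>, the second off the
  next \<open>b\<close>. Independence separates the two blocks; equality of the laws moves the
  second block to time 0.\<close>

lemma grid_prob_mult:
  assumes M: "M > 0" and D: "\<And>u v. D u v \<in> sets borel" and E: "\<And>v. E v \<in> sets borel"
  shows "prob (grid_event M a D \<inter> grid_path M (real a / M) b E) =
    prob (grid_event M a D) * prob (grid_path M 0 b E)"
proof -
  define A where "A = grid_event M a D"
  define B where "B s = grid_path M s b E" for s
  define \<xi> where "\<xi> i \<omega> = X (real (Suc i) / M) \<omega> - X (real i / M) \<omega>" for i :: nat and \<omega>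
  have \<xi>_meas [measurable]: "\<xi> i \<in> borel_measurable P" for i
    unfolding \<xi>_def by (intro borel_measurable_diff measurable_process) auto
  have indep: "indep_vars (\<lambda>_. borel) (\<lambda>i. \<xi> (k + i)) {..<n}" for k n
    using indep_increments[of "\<lambda>i. real (k + i) / M" n] unfolding \<xi>_def
    by (auto simp: divide_right_mono)
  have law: "distr P borel (\<xi> i) = distr P borel (X (1 / M))" for i
    using stationary_increments[of "real i / M" "real (Suc i) / M"] unfolding \<xi>_def
    by (simp add: divide_right_mono diff_divide_distrib[symmetric])
  have tele: "(\<Sum>i<j. \<xi> (k + i) \<omega>) = X (real (k + j) / M) \<omega> - X (real k / M) \<omega>" for k j \<omega>
    by (induction j) (auto simp: \<xi>_def)
  have tele0: "(\<Sum>i=j..<k. \<xi> i \<omega>) = X (real k / M) \<omega> - X (real j / M) \<omega>" if "j \<le> k" for j k \<omega>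
    unfolding \<xi>_def using that by (rule sum_Suc_diff')
  define vec where "vec k \<omega> = (\<lambda>i\<in>{..<b}. \<xi> (k + i) \<omega>)" for k \<omega>
  \<comment> \<open>Partial sums of increments telescope to path differences, so the events are
    preimages of measurable sets in finite products. \<open>SB\<close> and \<open>SB'\<close> are
    the same constraint over two index sets: \<open>{a..<a+b}\<close> fits the independence of the
    blocks, \<open>{..<b}\<close> the comparison of their laws.\<close>
  define SA where "SA = {g \<in> space (Pi\<^sub>M {..<a} (\<lambda>_. borel)). \<forall>k\<le>a. \<forall>j\<le>k. (\<Sum>i=j..<k. g i) \<in> D (real j / M) (real k / M)}"
  define SB where "SB = {g \<in> space (Pi\<^sub>M {..<b} (\<lambda>_. borel)). \<forall>j\<le>b. (\<Sum>i<j. g i) \<in> E (real j / M)}"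
  define SB' where "SB' = {g \<in> space (Pi\<^sub>M {a..<a+b} (\<lambda>_. borel)). \<forall>j\<le>b. (\<Sum>i<j. g (a + i)) \<in> E (real j / M)}"
  have SA: "SA \<in> sets (Pi\<^sub>M {..<a} (\<lambda>_. borel :: real measure))"
    unfolding SA_def by (measurable; use D in auto)
  have SB: "SB \<in> sets (Pi\<^sub>M {..<b} (\<lambda>_. borel :: real measure))"
    unfolding SB_def by (measurable; use E in auto)
  have SB': "SB' \<in> sets (Pi\<^sub>M {a..<a+b} (\<lambda>_. borel :: real measure))"
    unfolding SB'_def by (measurable; use E in auto)
  have vec_meas [measurable]: "vec k \<in> measurable P (Pi\<^sub>M {..<b} (\<lambda>_. borel))" for k
    unfolding vec_def by measurable
  have vec_law: "distr P (Pi\<^sub>M {..<b} (\<lambda>_. borel)) (vec k) = distr P (Pi\<^sub>M {..<b} (\<lambda>_. borel)) (vec 0)" for k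
  proof (cases "b = 0")
    case True
    then have "vec k = vec 0" by (simp add: vec_def fun_eq_iff)
    then show ?thesis by simp
  next
    case False
    \<comment> \<open>Every block of \<open>b\<close> increments has the product law of
      \<open>b\<close> copies of the law of \<open>X (1 / M)\<close>, whatever its start
      \<open>k\<close>.\<close>
    have "distr P (Pi\<^sub>M {..<b} (\<lambda>_. borel)) (vec k) = Pi\<^sub>M {..<b} (\<lambda>_. distr P borel (X (1 / M)))" for k
      using indep[of k b] indep_vars_iff_distr_eq_PiM[where I="{..<b}" and M'="\<lambda>_. borel" and X="\<lambda>i. \<xi> (k + i)"] False
      by (simp add: vec_def[abs_def] law lessThan_empty_iff)
    then show ?thesis by simp
  qed
  have restrict_sum: "(\<Sum>i<j. if i < m then f i else undefined) = (\<Sum>i<j. f i)" if "j \<le> m" for j m :: nat and f :: "nat \<Rightarrow> real"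
    using that by (intro sum.cong) auto
  have restrict_sum': "(\<Sum>i=j..<k. if i < m then f i else undefined) = (\<Sum>i=j..<k. f i)" if "k \<le> m" for j k m :: nat and f :: "nat \<Rightarrow> real"
    using that by (intro sum.cong) auto
  have vecB: "vec k -` SB \<inter> space P = B (real k / M)" for k
    unfolding B_def grid_path_def SB_def vec_def
    by (auto simp: space_PiM restrict_sum tele add_divide_distrib)
  have eqA: "(\<lambda>\<omega>. \<lambda>i\<in>{..<a}. \<xi> i \<omega>) -` SA \<inter> space P = A"
    unfolding A_def grid_event_def SA_def
    by (auto simp: space_PiM restrict_sum' tele0)
  have eqB: "(\<lambda>\<omega>. \<lambda>i\<in>{a..<a+b}. \<xi> i \<omega>) -` SB' \<inter> space P = B (real a / M)"
    unfolding B_def grid_path_def SB'_def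
    by (auto simp: space_PiM tele add_divide_distrib)
  have "(\<lambda>\<omega>. (\<lambda>i\<in>{..<a}. \<xi> i \<omega>, \<lambda>i\<in>{a..<a+b}. \<xi> i \<omega>)) -` (SA \<times> SB') \<inter> space P = A \<inter> B (real a / M)"
    unfolding eqA[symmetric] eqB[symmetric] by blast
  moreover have disj: "{..<a} \<inter> {a..<a+b} = {}" "{..<a} \<subseteq> {..<a+b}" "{a..<a+b} \<subseteq> {..<a+b}" by auto
  moreover have "indep_vars (\<lambda>_. borel) \<xi> {..<a+b}"
    using indep[of 0 "a + b"] by simp
  ultimately have "prob (A \<inter> B (real a / M)) = prob A * prob (B (real a / M))"
    using indep_varD[OF indep_var_restrict[of "\<lambda>_. borel" \<xi> "{..<a+b}" "{..<a}" "{a..<a+b}"] SA SB']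
    by (simp add: eqA eqB)
  also have "prob (B (real a / M)) = measure (distr P (Pi\<^sub>M {..<b} (\<lambda>_. borel)) (vec a)) SB"
    by (simp add: measure_distr SB vecB)
  also have "\<dots> = prob (B 0)"
    unfolding vec_law[of a] using vecB[of 0] by (simp add: measure_distr SB)
  finally show ?thesis by (simp only: A_def B_def)
qed

section \<open>Passage from grids to all rational times\<close>

lemma grid_path_sets:
  assumes "0 \<le> s" and D: "\<And>v. D v \<in> sets borel"
  shows "grid_path M s b D \<in> sets P"
proof -
  have "grid_path M s b D = (\<Inter>j\<le>b. (\<lambda>\<omega>. X (s + real j / M) \<omega> - X s \<omega>) -` D (real j / M) \<inter> space P)"
    unfolding grid_path_def by auto
  also have "\<dots> \<in> sets P"
    using assms by (intro sets.finite_INT measurable_sets[OF _ D] borel_measurable_diff measurable_process) auto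
  finally show ?thesis .
qed

text \<open>Along divisibility the grids are nested, so the events decrease and continuity from
  above becomes available.\<close>

lemma grid_path_refine:
  assumes "k dvd l" "l > 0"
  shows "grid_path (M * l) s (b * l) D \<subseteq> grid_path (M * k) s (b * k) D"
proof
  fix \<omega> assume *: "\<omega> \<in> grid_path (M * l) s (b * l) D"
  obtain c where c: "l = k * c" using assms by auto
  have "c > 0" "k > 0" using assms c by auto
  have "X (s + real j / real (M * k)) \<omega> - X s \<omega> \<in> D (real j / real (M * k))" if "j \<le> b * k" for j
  proof -
    have "real (j * c) / real (M * l) = real j / real (M * k)" using \<open>c > 0\<close> by (simp add: c)
    moreover have "j * c \<le> b * l" using that by (simp add: c)
    ultimately show ?thesis using * unfolding grid_path_def by (smt (verit) mem_Collect_eq)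
  qed
  then show "\<omega> \<in> grid_path (M * k) s (b * k) D" using * by (simp add: grid_path_def)
qed

text \<open>The grids of mesh \<open>1 / (M * fact m)\<close> exhaust the rationals, because
  \<open>fact q\<close> is a multiple of any given denominator \<open>q > 0\<close>.\<close>

lemma inc_path_eq_Inter_grid_path:
  assumes M: "M > 0"
  shows "inc_path s (real b / M) D = (\<Inter>m. grid_path (M * fact m) s (b * fact m) D)" (is "?L = ?R")
proof
  show "?L \<subseteq> ?R"
  proof (safe)
    fix \<omega> m assume *: "\<omega> \<in> ?L"
    have "real j / real (M * fact m) \<in> \<rat> \<inter> {0..real b / M}" if "j \<le> b * fact m" for j
    proof -
      have "real j \<le> real b * fact m" using that by (metis of_nat_fact of_nat_le_iff of_nat_mult)
      moreover have "real j / real (M * fact m) \<in> \<rat>" by (intro Rats_divide Rats_of_nat)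
      ultimately show ?thesis using M by (auto simp: field_simps)
    qed
    then show "\<omega> \<in> grid_path (M * fact m) s (b * fact m) D"
      using * unfolding inc_path_def grid_path_def by auto
  qed
  show "?R \<subseteq> ?L"
  proof
    fix \<omega> assume *: "\<omega> \<in> ?R"
    have "X (s + v) \<omega> - X s \<omega> \<in> D v" if v: "v \<in> \<rat>" "0 \<le> v" "v \<le> real b / M" for v
    proof -
      obtain p q :: nat where pq: "q > 0" "v = real p / real q"
        using nonneg_Rats_cases[OF v(1) v(2)] by blast
      obtain c where c: "fact q = q * c" using \<open>q > 0\<close> by (metis dvd_fact dvdE le_refl One_nat_def Suc_leI)
      have "c > 0" using c by (metis fact_gt_zero mult_0_right gr0I less_numeral_extra(3))
      have eq: "real (p * M * c) / real (M * fact q) = v"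
        using \<open>c > 0\<close> M pq by (simp add: c)
      have "real p * real M \<le> real b * real q" using v(3) M pq by (simp add: field_simps)
      then have "p * M \<le> b * q" by (metis of_nat_le_iff of_nat_mult)
      then have "p * M * c \<le> b * fact q" by (simp add: c mult.assoc[symmetric])
      moreover have "\<omega> \<in> grid_path (M * fact q) s (b * fact q) D" using * by auto
      ultimately show ?thesis unfolding grid_path_def using eq by (smt (verit) mem_Collect_eq)
    qed
    moreover have "\<omega> \<in> space P" using * by (auto simp: grid_path_def)
    ultimately show "\<omega> \<in> ?L" by (auto simp: inc_path_def)
  qed
qed

definition incr_event :: "real \<Rightarrow> (real \<Rightarrow> real \<Rightarrow> real set) \<Rightarrow> 'a set" where
  "incr_event s D = {\<omega> \<in> space P. \<forall>v\<in>\<rat> \<inter> {0..s}. \<forall>u\<in>\<rat> \<inter> {0..v}. X v \<omega> - X u \<omega> \<in> D u v}"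

lemma grid_event_sets:
  assumes D: "\<And>u v. D u v \<in> sets borel"
  shows "grid_event M a D \<in> sets P"
proof -
  have "grid_event M a D =
    (\<Inter>k\<le>a. \<Inter>j\<le>k. (\<lambda>\<omega>. X (real k / M) \<omega> - X (real j / M) \<omega>) -` D (real j / M) (real k / M) \<inter> space P)"
    unfolding grid_event_def by auto
  also have "\<dots> \<in> sets P"
    using assms by (intro sets.finite_INT measurable_sets[OF _ D] borel_measurable_diff measurable_process) auto
  finally show ?thesis .
qed

lemma grid_event_refine:
  assumes "k dvd l" "l > 0"
  shows "grid_event (M * l) (a * l) D \<subseteq> grid_event (M * k) (a * k) D"
proof
  fix \<omega> assume *: "\<omega> \<in> grid_event (M * l) (a * l) D"
  obtain c where c: "l = k * c" using assms by auto
  have "c > 0" "k > 0" using assms c by auto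
  have eq: "real (j * c) / real (M * l) = real j / real (M * k)" for j
    using \<open>c > 0\<close> by (simp add: c)
  have "X (real i / real (M * k)) \<omega> - X (real j / real (M * k)) \<omega> \<in> D (real j / real (M * k)) (real i / real (M * k))"
    if "i \<le> a * k" "j \<le> i" for i j
  proof -
    have "i * c \<le> a * l" "j * c \<le> i * c" using that by (auto simp: c)
    then show ?thesis using * unfolding grid_event_def eq[symmetric] by blast
  qed
  then show "\<omega> \<in> grid_event (M * k) (a * k) D" using * by (simp add: grid_event_def)
qed

lemma incr_event_eq_Inter_grid_event:
  assumes M: "M > 0"
  shows "incr_event (real a / M) D = (\<Inter>m. grid_event (M * fact m) (a * fact m) D)" (is "?L = ?R")
proof
  show "?L \<subseteq> ?R"
  proof (safe)
    fix \<omega> m assume *: "\<omega> \<in> ?L"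
    have rat: "real j / real (M * fact m) \<in> \<rat>" for j by (intro Rats_divide Rats_of_nat)
    have le: "real j / real (M * fact m) \<le> real k / real (M * fact m)" if "j \<le> k" for j k
      using that by (intro divide_right_mono) auto
    have "real k / real (M * fact m) \<le> real a / M" if "k \<le> a * fact m" for k
      using le[OF that] by simp
    then show "\<omega> \<in> grid_event (M * fact m) (a * fact m) D"
      using * rat le unfolding incr_event_def grid_event_def by auto
  qed
  show "?R \<subseteq> ?L"
  proof
    fix \<omega> assume *: "\<omega> \<in> ?R"
    have "X v \<omega> - X u \<omega> \<in> D u v"
      if v: "v \<in> \<rat>" "0 \<le> v" "v \<le> real a / M" and u: "u \<in> \<rat>" "0 \<le> u" "u \<le> v" for u v
    proof -
      obtain p q :: nat where pq: "q > 0" "v = real p / real q"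
        using nonneg_Rats_cases[OF v(1,2)] by blast
      obtain p' q' :: nat where pq': "q' > 0" "u = real p' / real q'"
        using nonneg_Rats_cases[OF u(1,2)] by blast
      \<comment> \<open>A common denominator puts both times on one grid.\<close>
      define Q where "Q = q * q'"
      have "Q > 0" using pq pq' by (simp add: Q_def)
      obtain c where c: "fact Q = Q * c"
        using \<open>Q > 0\<close> by (metis dvd_fact dvdE le_refl One_nat_def Suc_leI)
      have "c > 0" using c by (metis fact_gt_zero mult_0_right gr0I less_numeral_extra(3))
      have v_eq: "real (p * q' * M * c) / real (M * fact Q) = v"
        and u_eq: "real (p' * q * M * c) / real (M * fact Q) = u"
        unfolding c using \<open>c > 0\<close> M pq pq' by (simp_all add: Q_def)
      have F: "real (M * fact Q) > 0" using M by simp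
      have "real (p * q' * M * c) = v * real (M * fact Q)"
        unfolding v_eq[symmetric] using F by simp
      also have "\<dots> \<le> real a / M * real (M * fact Q)"
        using v(3) F by (intro mult_right_mono) auto
      also have "\<dots> = real (a * fact Q)" using M by simp
      finally have "p * q' * M * c \<le> a * fact Q" by (simp only: of_nat_le_iff)
      moreover have "real (p' * q * M * c) \<le> real (p * q' * M * c)"
        using u(3) F unfolding v_eq[symmetric] u_eq[symmetric] by (simp only: divide_le_cancel)
      then have "p' * q * M * c \<le> p * q' * M * c" by (simp only: of_nat_le_iff)
      moreover have "\<omega> \<in> grid_event (M * fact Q) (a * fact Q) D" using * by auto
      ultimately show ?thesis
        unfolding grid_event_def v_eq[symmetric] u_eq[symmetric] by blast
    qed
    moreover have "\<omega> \<in> space P" using * by (auto simp: grid_event_def)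
    ultimately show "\<omega> \<in> ?L" by (auto simp: incr_event_def)
  qed
qed

text \<open>The product formula holds on every grid of a nested sequence whose first grid already
  contains \<open>s\<close> and \<open>s + T\<close>; continuity from above carries it to the
  limit.\<close>

lemma incr_event_prob_mult:
  assumes s: "s \<in> \<rat>" "0 \<le> s" and T: "T \<in> \<rat>" "0 \<le> T"
    and D: "\<And>u v. D u v \<in> sets borel" and E: "\<And>v. E v \<in> sets borel"
  shows "prob (incr_event s D \<inter> inc_path s T E) = prob (incr_event s D) * prob (inc_path 0 T E)"
proof -
  obtain p q :: nat where pq: "q > 0" "s = real p / real q"
    using nonneg_Rats_cases[OF s(1) s(2)] by blast
  obtain p' q' :: nat where pq': "q' > 0" "T = real p' / real q'"
    using nonneg_Rats_cases[OF T(1) T(2)] by blast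
  define M a b where "M = q * q'" and "a = p * q'" and "b = p' * q"
  have M: "M > 0" and sa: "s = real a / M" and Tb: "T = real b / M"
    using pq pq' by (auto simp: M_def a_def b_def)
  define A B C where "A m = grid_event (M * fact m) (a * fact m) D"
    and "B m = grid_path (M * fact m) s (b * fact m) E"
    and "C m = grid_path (M * fact m) 0 (b * fact m) E" for m
  have sets: "A m \<in> sets P" "B m \<in> sets P" "C m \<in> sets P" for m
    unfolding A_def B_def C_def using s D E by (auto intro: grid_path_sets grid_event_sets)
  have dec: "decseq A" "decseq B" "decseq C"
    unfolding A_def B_def C_def antimono_def
    using grid_path_refine[OF fact_dvd fact_gt_zero] grid_event_refine[OF fact_dvd fact_gt_zero] by blast+
  have "decseq (\<lambda>m. A m \<inter> B m)"
    using dec unfolding decseq_def by blast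
  then have "(\<lambda>m. prob (A m \<inter> B m)) \<longlonglongrightarrow> prob (\<Inter>m. A m \<inter> B m)"
    by (intro finite_Lim_measure_decseq) (use sets in auto)
  moreover have "(\<lambda>m. prob (A m) * prob (C m)) \<longlonglongrightarrow> prob (\<Inter>m. A m) * prob (\<Inter>m. C m)"
    by (intro tendsto_mult finite_Lim_measure_decseq dec) (use sets in auto)
  moreover have "prob (A m \<inter> B m) = prob (A m) * prob (C m)" for m
    using grid_prob_mult[of "M * fact m" D E "a * fact m" "b * fact m"] M D E
    by (simp add: A_def B_def C_def sa)
  ultimately have "prob (\<Inter>m. A m \<inter> B m) = prob (\<Inter>m. A m) * prob (\<Inter>m. C m)"
    using LIMSEQ_unique by simp
  moreover have "(\<Inter>m. A m \<inter> B m) = incr_event s D \<inter> inc_path s T E"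
    unfolding A_def B_def Tb inc_path_eq_Inter_grid_path[OF M] incr_event_eq_Inter_grid_event[OF M] sa by auto
  moreover have "(\<Inter>m. A m) = incr_event s D" "(\<Inter>m. C m) = inc_path 0 T E"
    unfolding A_def C_def Tb inc_path_eq_Inter_grid_path[OF M] incr_event_eq_Inter_grid_event[OF M] sa by auto
  ultimately show ?thesis by simp
qed

text \<open>With a trivial past only the stationarity half of the product formula remains.\<close>

lemma inc_path_prob_shift:
  assumes s: "s \<in> \<rat>" "0 \<le> s" and T: "T \<in> \<rat>" "0 \<le> T" and E: "\<And>v. E v \<in> sets borel"
  shows "prob (inc_path s T E) = prob (inc_path 0 T E)"
proof -
  have "incr_event s (\<lambda>_ _. UNIV) = space P" by (auto simp: incr_event_def)
  moreover have "inc_path s T E \<subseteq> space P" by (auto simp: inc_path_def)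
  ultimately show ?thesis using incr_event_prob_mult[OF s T, of "\<lambda>_ _. UNIV" E] E
    by (simp add: prob_space Int_absorb1)
qed

text \<open>
  Constraints on all pairs of times, rather than on the path alone, make this class closed under adding
  constraints on a later segment.
\<close>

definition past :: "real \<Rightarrow> 'a set \<Rightarrow> bool" where
  "past s A \<longleftrightarrow> (\<exists>D. (\<forall>u v. D u v \<in> sets borel) \<and> A = incr_event s D)"

lemma past_inc_path:
  assumes "\<And>v. D v \<in> sets borel"
  shows "past s (inc_path 0 s D)"
  unfolding past_def
proof (intro exI[of _ "\<lambda>u v. if u = 0 then D v else UNIV"] conjI allI)
  show "inc_path 0 s D = incr_event s (\<lambda>u v. if u = 0 then D v else UNIV)"
    unfolding inc_path_def incr_event_def by auto
qed (use assms in auto)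

lemma past_mult:
  assumes "past s A" "s \<in> \<rat>" "0 \<le> s" "T \<in> \<rat>" "0 \<le> T" "\<And>v. E v \<in> sets borel"
  shows "prob (A \<inter> inc_path s T E) = prob A * prob (inc_path 0 T E)"
  using assms(1) incr_event_prob_mult[OF assms(2-5) _ assms(6)] by (auto simp: past_def)

lemma past_Int_inc_path:
  assumes A: "past s A" and s: "s \<in> \<rat>" "0 \<le> s" and T: "0 \<le> T" and E: "\<And>v. E v \<in> sets borel"
  shows "past (s + T) (A \<inter> inc_path s T E)"
proof -
  obtain D where D: "\<And>u v. D u v \<in> sets borel" "A = incr_event s D"
    using A by (auto simp: past_def)
  \<comment> \<open>The old constraints stay on the pairs with \<open>v \<le> s\<close>; the new
    segment is encoded in the pairs that start at \<open>u = s\<close>.\<close>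
  define D' where "D' u v = (if v \<le> s then D u v else UNIV) \<inter> (if u = s then E (v - s) else UNIV)" for u v
  have "A \<inter> inc_path s T E = incr_event (s + T) D'"
  proof (intro set_eqI iffI)
    fix \<omega> assume *: "\<omega> \<in> A \<inter> inc_path s T E"
    have "X v \<omega> - X u \<omega> \<in> D' u v" if "v \<in> \<rat>" "v \<le> s + T" "u \<in> \<rat>" "0 \<le> u" "u \<le> v" for u v
    proof -
      have "X v \<omega> - X u \<omega> \<in> D u v" if "v \<le> s"
        using * that \<open>v \<in> \<rat>\<close> \<open>u \<in> \<rat>\<close> \<open>0 \<le> u\<close> \<open>u \<le> v\<close> by (auto simp: D(2) incr_event_def)
      moreover have "X v \<omega> - X u \<omega> \<in> E (v - s)" if "u = s"
      proof -
        have "v - s \<in> \<rat> \<inter> {0..T}" using that \<open>v \<in> \<rat>\<close> \<open>u \<le> v\<close> \<open>v \<le> s + T\<close> s by auto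
        then have "X (s + (v - s)) \<omega> - X s \<omega> \<in> E (v - s)" using * unfolding inc_path_def by blast
        then show ?thesis using that by simp
      qed
      ultimately show ?thesis by (auto simp: D'_def)
    qed
    then show "\<omega> \<in> incr_event (s + T) D'" using * by (auto simp: incr_event_def inc_path_def)
  next
    fix \<omega> assume *: "\<omega> \<in> incr_event (s + T) D'"
    have inc: "X v \<omega> - X u \<omega> \<in> D' u v" if "v \<in> \<rat>" "v \<le> s + T" "u \<in> \<rat>" "0 \<le> u" "u \<le> v" for u v
      using * that by (auto simp: incr_event_def)
    have "\<omega> \<in> space P" using * by (simp add: incr_event_def)
    have "X v \<omega> - X u \<omega> \<in> D u v" if "v \<in> \<rat>" "v \<le> s" "u \<in> \<rat>" "0 \<le> u" "u \<le> v" for u v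
      using inc[of v u] that T by (simp add: D'_def)
    moreover have "X (s + v) \<omega> - X s \<omega> \<in> E v" if "v \<in> \<rat>" "0 \<le> v" "v \<le> T" for v
      using inc[of "s + v" s] that s by (simp add: D'_def)
    ultimately show "\<omega> \<in> A \<inter> inc_path s T E"
      using \<open>\<omega> \<in> space P\<close> by (auto simp: D(2) incr_event_def inc_path_def)
  qed
  moreover have "D' u v \<in> sets borel" for u v unfolding D'_def using D(1) E by auto
  ultimately show ?thesis unfolding past_def by blast
qed

end

section \<open>Jumps and increments over grid cells\<close>

text \<open>By Lindelof countably many of the balls cover \<open>A\<close>, so only countably many
  null sets are discarded even though \<open>A\<close> may be uncountable.\<close>

lemma AE_disjoint_of_local:
  fixes S :: "'b \<Rightarrow> real set"
  assumes "\<And>a. a \<in> A \<Longrightarrow> \<exists>r>0. AE \<omega> in M. S \<omega> \<inter> ball a r = {}"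
  shows "AE \<omega> in M. S \<omega> \<inter> A = {}"
proof -
  obtain r where r: "\<And>a. a \<in> A \<Longrightarrow> r a > 0 \<and> (AE \<omega> in M. S \<omega> \<inter> ball a (r a) = {})"
    using assms by metis
  obtain F where F: "F \<subseteq> (\<lambda>a. ball a (r a)) ` A" "countable F" "\<Union>F = \<Union>((\<lambda>a. ball a (r a)) ` A)"
    by (rule Lindelof[of "(\<lambda>a. ball a (r a)) ` A"]) auto
  have "AE \<omega> in M. \<forall>B\<in>F. S \<omega> \<inter> B = {}"
    using F(1) r by (subst AE_ball_countable[OF F(2)]) auto
  moreover have "A \<subseteq> \<Union>F"
    unfolding F(3) using r by (auto intro!: bexI)
  ultimately show ?thesis
    by (elim AE_mp, intro AE_I2) blast
qed

text \<open>Modelled on a path with one jump of about \<open>a\<close> in a cell of length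
  \<open>T\<close>: close to 0 before the jump, close to \<open>a\<close> after it, and certainly
  close to \<open>a\<close> at the end.\<close>

definition tube_sets :: "real \<Rightarrow> real \<Rightarrow> real \<Rightarrow> real \<Rightarrow> real set" where
  "tube_sets T a \<eta> v = (ball 0 \<eta> \<union> ball a \<eta>) \<inter> (if v = T then ball a \<eta> else UNIV)"

lemma tube_sets_borel: "tube_sets T a \<eta> v \<in> sets borel"
  by (auto simp: tube_sets_def intro!: sets.Int sets.Un)

lemma cadlag_right:
  assumes "cadlag f" "0 \<le> t" "0 < \<theta>"
  obtains \<epsilon> where "0 < \<epsilon>" "\<And>v. t \<le> v \<Longrightarrow> v < t + \<epsilon> \<Longrightarrow> \<bar>f v - f t\<bar> < \<theta>"
proof -
  have "(f \<longlongrightarrow> f t) (at_right t)"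
    using assms by (simp add: cadlag_def continuous_within)
  then have "eventually (\<lambda>v. dist (f v) (f t) < \<theta>) (at_right t)"
    using assms(3) by (rule tendstoD)
  then obtain b where b: "b > t" "\<And>v. t < v \<Longrightarrow> v < b \<Longrightarrow> dist (f v) (f t) < \<theta>"
    by (auto simp: eventually_at_right_field)
  show thesis
    by (rule that[of "b - t"]) (use b assms(3) in \<open>auto simp: dist_real_def less_eq_real_def\<close>)
qed

lemma cadlag_left:
  assumes "cadlag f" "0 < t" "0 < \<theta>"
  obtains \<epsilon> where "0 < \<epsilon>" "\<And>v. t - \<epsilon> < v \<Longrightarrow> v < t \<Longrightarrow> \<bar>f v - Lim (at_left t) f\<bar> < \<theta>"
proof -
  obtain l where l: "(f \<longlongrightarrow> l) (at_left t)"
    using assms by (auto simp: cadlag_def)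
  have "Lim (at_left t) f = l"
    by (rule tendsto_Lim[OF _ l]) simp
  have "eventually (\<lambda>v. dist (f v) l < \<theta>) (at_left t)"
    using l assms(3) by (rule tendstoD)
  then obtain b where b: "b < t" "\<And>v. b < v \<Longrightarrow> v < t \<Longrightarrow> dist (f v) l < \<theta>"
    by (auto simp: eventually_at_left_field)
  show thesis
    by (rule that[of "t - b"]) (use b \<open>Lim (at_left t) f = l\<close> in \<open>auto simp: dist_real_def\<close>)
qed

lemma inverse_nat_eventually_less:
  fixes \<epsilon> :: real
  assumes "\<epsilon> > 0"
  shows "\<exists>m>0. \<forall>N\<ge>m. 1 / real N < \<epsilon>"
proof -
  obtain n :: nat where n: "1 / real (Suc n) < \<epsilon>"
    using reals_Archimedean[OF assms] by (auto simp: inverse_eq_divide)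
  show ?thesis
  proof (intro exI[of _ "Suc n"] conjI allI impI)
    fix N assume "Suc n \<le> N"
    then have "1 / real N \<le> 1 / real (Suc n)" by (intro divide_left_mono) auto
    with n show "1 / real N < \<epsilon>" by linarith
  qed simp
qed

text \<open>In a short cell around \<open>t\<close> the path is close to its left limit before
  \<open>t\<close> and close to \<open>f t\<close> from \<open>t\<close> on, so its increments are
  close to 0 and then close to the jump.\<close>

lemma jump_in_cell:
  assumes f: "cadlag f" and t: "0 < t" "t \<le> 1" and J: "\<bar>jump f t - a\<bar> < \<eta>"
  shows "\<exists>m. \<forall>N\<ge>m. \<exists>i<N. \<forall>v\<in>{0..1 / real N}. f (real i / N + v) - f (real i / N) \<in> tube_sets (1 / real N) a \<eta> v"
proof -
  \<comment> \<open>Half of the slack: both endpoints of an increment contribute an error.\<close>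
  define \<theta> where "\<theta> = (\<eta> - \<bar>jump f t - a\<bar>) / 2"
  have \<theta>: "\<theta> > 0" "\<bar>jump f t - a\<bar> + 2 * \<theta> = \<eta>" using J unfolding \<theta>_def by (simp, argo)
  define l where "l = Lim (at_left t) f"
  have J_eq: "jump f t = f t - l" by (simp add: jump_def l_def)
  obtain \<epsilon>1 where \<epsilon>1: "0 < \<epsilon>1" "\<And>v. t \<le> v \<Longrightarrow> v < t + \<epsilon>1 \<Longrightarrow> \<bar>f v - f t\<bar> < \<theta>"
    using cadlag_right[OF f less_imp_le[OF t(1)] \<theta>(1)] by blast
  obtain \<epsilon>2 where \<epsilon>2: "0 < \<epsilon>2" "\<And>v. t - \<epsilon>2 < v \<Longrightarrow> v < t \<Longrightarrow> \<bar>f v - l\<bar> < \<theta>"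
    using cadlag_left[OF f t(1) \<theta>(1)] unfolding l_def by blast
  obtain m :: nat where m: "m > 0" "\<And>N. m \<le> N \<Longrightarrow> 1 / real N < min \<epsilon>1 \<epsilon>2"
    using inverse_nat_eventually_less[of "min \<epsilon>1 \<epsilon>2"] \<epsilon>1(1) \<epsilon>2(1) by (metis min_less_iff_conj)
  show ?thesis
  proof (rule exI[of _ m], intro allI impI)
    fix N assume "N \<ge> m"
    then have N: "N > 0" "1 / real N < \<epsilon>1" "1 / real N < \<epsilon>2"
      using m(1) m(2)[of N] by auto
    \<comment> \<open>Rounding up and subtracting 1 puts the left end strictly before
      \<open>t\<close>, even if \<open>t\<close> is a grid point, so the jump belongs to this
      cell.\<close>
    define i where "i = nat (\<lceil>t * N\<rceil> - 1)"
    have "\<lceil>t * N\<rceil> \<ge> 1" using t N by simp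
    then have "real i = of_int \<lceil>t * N\<rceil> - 1" by (simp add: i_def)
    then have "real i < t * N" "t * N \<le> real i + 1" by linarith+
    then have i: "real i / N < t" "t \<le> real i / N + 1 / N"
      using N by (auto simp: field_simps)
    have "real i / real N < 1" using i t by linarith
    then have "i < N" using N by (simp add: field_simps)
    moreover have "f (real i / N + v) - f (real i / N) \<in> tube_sets (1 / real N) a \<eta> v"
      if v: "v \<in> {0..1 / real N}" for v
    proof -
      have 1: "\<bar>f (real i / N) - l\<bar> < \<theta>" by (rule \<epsilon>2) (use i N in linarith)+
      show ?thesis
      proof (cases "real i / N + v < t")
        case True
        have "\<bar>f (real i / N + v) - l\<bar> < \<theta>" by (rule \<epsilon>2) (use i N v True in auto)
        then have "f (real i / N + v) - f (real i / N) \<in> ball 0 \<eta>"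
          using 1 \<theta> unfolding mem_ball dist_real_def by linarith
        moreover have "v \<noteq> 1 / N" using True i by auto
        ultimately show ?thesis by (simp add: tube_sets_def)
      next
        case False
        have "\<bar>f (real i / N + v) - f t\<bar> < \<theta>" by (rule \<epsilon>1) (use i N v False in auto)
        then have "f (real i / N + v) - f (real i / N) \<in> ball a \<eta>"
          using 1 \<theta> J_eq unfolding mem_ball dist_real_def by linarith
        then show ?thesis
          by (cases "v = 1 / real N") (simp_all add: tube_sets_def del: mem_ball)
      qed
    qed
    ultimately show "\<exists>i<N. \<forall>v\<in>{0..1 / real N}. f (real i / N + v) - f (real i / N) \<in> tube_sets (1 / real N) a \<eta> v"
      by blast
  qed
qed

section \<open>Support points of the Levy measure\<close>

context levy_process
begin

definition tube :: "real \<Rightarrow> real \<Rightarrow> real \<Rightarrow> 'a set" where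
  "tube T a \<eta> = inc_path 0 T (tube_sets T a \<eta>)"

lemma tube_events: "tube T a \<eta> \<in> sets P"
  unfolding tube_def by (rule inc_path_sets) (auto simp: tube_sets_borel)

lemma prob_pos_of_not_AE:
  assumes "A \<in> sets P" "\<not> (AE \<omega> in P. \<omega> \<notin> A)"
  shows "prob A > 0"
  using assms prob_eq_0[of A] measure_nonneg[of P A] by linarith

text \<open>By right continuity at 0 almost every path lies in one of countably many events, so one
  of them has positive probability.\<close>

lemma small_noise:
  assumes "\<eta> > 0" "\<tau> > 0"
  obtains T where "T \<in> \<rat>" "0 < T" "T < \<tau>" "prob (inc_path 0 T (\<lambda>_. ball 0 \<eta>)) > 0"
proof -
  obtain k :: nat where k: "k > 0" "1 / real k < \<tau>"
    using inverse_nat_eventually_less[OF assms(2)] by blast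
  define A where "A n = inc_path 0 (1 / real (k + n)) (\<lambda>_. ball 0 \<eta>)" for n
  have A: "A n \<in> sets P" for n unfolding A_def by (rule inc_path_sets) auto
  have "\<exists>n. prob (A n) > 0"
  proof (rule ccontr)
    assume "\<not> ?thesis"
    then have "AE \<omega> in P. \<omega> \<notin> A n" for n
      using prob_pos_of_not_AE[OF A] by blast
    then have "AE \<omega> in P. \<forall>n. \<omega> \<notin> A n" by (simp add: AE_all_countable)
    then have "AE \<omega> in P. False"
      using cadlag_paths AE_space
    proof eventually_elim
      case (elim \<omega>)
      obtain \<epsilon> where \<epsilon>: "0 < \<epsilon>" "\<And>v. 0 \<le> v \<Longrightarrow> v < 0 + \<epsilon> \<Longrightarrow> \<bar>X v \<omega> - X 0 \<omega>\<bar> < \<eta>"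
        using cadlag_right[OF elim(2), of 0 \<eta>] assms by auto
      obtain n :: nat where n: "n > 0" "1 / real n < \<epsilon>"
        using inverse_nat_eventually_less[OF \<epsilon>(1)] by blast
      have "1 / real (k + n) \<le> 1 / real n" using n by (simp add: frac_le)
      then have "\<omega> \<notin> space P"
        using elim(1)[rule_format, of n] \<epsilon>(2) n by (auto simp: A_def inc_path_def dist_real_def abs_minus_commute)
      with elim(3) show False by blast
    qed
    then show False by simp
  qed
  then obtain n where "prob (A n) > 0" ..
  moreover have "1 / real (k + n) \<le> 1 / real k" using k by (simp add: frac_le)
  ultimately show thesis
    using k by (intro that[of "1 / real (k + n)"]) (auto simp: A_def)
qed

text \<open>By a union bound over the \<open>N\<close> cells, some cell shows a tube path with
  probability at most \<open>N\<close> times that of one tube. If no bound \<open>c / N\<close>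
  holds, this is arbitrarily small for suitable large \<open>N\<close>, so the event that all fine
  grids have such a cell is null.\<close>

lemma rare_tube_null:
  assumes "\<not> (\<exists>c>0. \<forall>\<^sub>F N in sequentially. prob (tube (1 / real N) a \<eta>) \<ge> c / real N)"
  shows "AE \<omega> in P. \<not> (\<exists>m. \<forall>N\<ge>m. \<exists>i<N. \<omega> \<in> inc_path (real i / N) (1 / real N) (tube_sets (1 / real N) a \<eta>))"
proof -
  define C where "C N i = inc_path (real i / real N) (1 / real N) (tube_sets (1 / real N) a \<eta>)" for N i :: nat
  have C: "C N i \<in> sets P" for N i
    unfolding C_def by (rule inc_path_sets) (auto simp: tube_sets_borel)
  have CP: "prob (C N i) = prob (tube (1 / real N) a \<eta>)" for N i
    unfolding C_def tube_def by (rule inc_path_prob_shift) (auto simp: tube_sets_borel)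
  have "AE \<omega> in P. \<not> (\<forall>N\<ge>m. \<exists>i<N. \<omega> \<in> C N i)" for m
  proof -
    define Z where "Z = (\<Inter>N\<in>{m..}. \<Union>i<N. C N i)"
    have Z: "Z \<in> sets P" unfolding Z_def using C by (intro sets.countable_INT') auto
    have "prob Z \<le> c" if "c > 0" for c
    proof -
      have "\<exists>\<^sub>F N in sequentially. \<not> prob (tube (1 / real N) a \<eta>) \<ge> c / real N"
        using assms that by (auto simp: frequently_def)
      then obtain N where N: "N \<ge> max m 1" "prob (tube (1 / real N) a \<eta>) < c / real N"
        unfolding frequently_sequentially by (meson linorder_not_le)
      have "prob Z \<le> prob (\<Union>i<N. C N i)"
        using N C by (intro finite_measure_mono) (auto simp: Z_def)
      also have "\<dots> \<le> (\<Sum>i<N. prob (C N i))"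
        using C by (intro finite_measure_subadditive_finite) auto
      also have "\<dots> = real N * prob (tube (1 / real N) a \<eta>)" by (simp add: CP)
      also have "\<dots> \<le> c" using N by (simp add: field_simps)
      finally show ?thesis .
    qed
    then have "prob Z \<le> 0" by (intro field_le_epsilon[of "prob Z" 0]) simp
    then have "prob Z = 0" using measure_nonneg[of P Z] by linarith
    then have "AE \<omega> in P. \<omega> \<notin> Z" using Z prob_eq_0 by blast
    then show ?thesis by eventually_elim (auto simp: Z_def)
  qed
  then show ?thesis by (simp add: AE_all_countable C_def)
qed

text \<open>Otherwise every nonzero point of \<open>A\<close> has a neighbourhood that almost surely
  contains no jump. By the covering argument almost surely no nonzero jump lies in \<open>A\<close>,
  and the expected number of jumps vanishes.\<close>

lemma levy_measure_charged:
  assumes "levy_measure P X A > 0"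
  shows "\<exists>a\<in>A - {0}. \<forall>\<eta>>0. \<exists>c>0. \<forall>\<^sub>F N in sequentially. prob (tube (1 / real N) a \<eta>) \<ge> c / real N"
proof (rule ccontr)
  define S where "S \<omega> = {jump (\<lambda>s. X s \<omega>) t |t. 0 < t \<and> t \<le> 1}" for \<omega>
  assume "\<not> ?thesis"
  then have neg: "\<exists>\<eta>>0. \<not> (\<exists>c>0. \<forall>\<^sub>F N in sequentially. prob (tube (1 / real N) a \<eta>) \<ge> c / real N)"
    if "a \<in> A - {0}" for a
    using that by blast
  have "AE \<omega> in P. S \<omega> \<inter> (A - {0}) = {}"
  proof (rule AE_disjoint_of_local)
    fix a assume "a \<in> A - {0}"
    from neg[OF this] obtain \<eta> where \<eta>: "\<eta> > 0" "\<not> (\<exists>c>0. \<forall>\<^sub>F N in sequentially. prob (tube (1 / real N) a \<eta>) \<ge> c / real N)"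
      by blast
    have "AE \<omega> in P. S \<omega> \<inter> ball a \<eta> = {}"
      using rare_tube_null[OF \<eta>(2)] cadlag_paths AE_space
    proof eventually_elim
      case (elim \<omega>)
      show ?case
      proof (rule ccontr)
        assume "S \<omega> \<inter> ball a \<eta> \<noteq> {}"
        then obtain t where t: "0 < t" "t \<le> 1" "\<bar>jump (\<lambda>s. X s \<omega>) t - a\<bar> < \<eta>"
          by (auto simp: S_def dist_real_def abs_minus_commute)
        obtain m where m: "\<And>N. N \<ge> m \<Longrightarrow> \<exists>i<N. \<forall>v\<in>{0..1 / real N}. X (real i / N + v) \<omega> - X (real i / N) \<omega> \<in> tube_sets (1 / real N) a \<eta> v"
          using jump_in_cell[OF elim(2) t] by blast
        have "\<exists>i<N. \<omega> \<in> inc_path (real i / N) (1 / real N) (tube_sets (1 / real N) a \<eta>)" if "N \<ge> m" for N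
          using m[OF that] elim(3) unfolding inc_path_def by blast
        with elim(1) show False by blast
      qed
    qed
    then show "\<exists>r>0. AE \<omega> in P. S \<omega> \<inter> ball a r = {}" using \<eta>(1) by blast
  qed
  then have "AE \<omega> in P. emeasure (count_space UNIV) {t \<in> {0<..1}. jump (\<lambda>s. X s \<omega>) t \<noteq> 0 \<and> jump (\<lambda>s. X s \<omega>) t \<in> A} = 0"
  proof eventually_elim
    case (elim \<omega>)
    then have "{t \<in> {0<..1}. jump (\<lambda>s. X s \<omega>) t \<noteq> 0 \<and> jump (\<lambda>s. X s \<omega>) t \<in> A} = {}"
      by (auto simp: S_def)
    then show ?case by (simp only: emeasure_empty)
  qed
  then have "levy_measure P X A = (\<integral>\<^sup>+\<omega>. 0 \<partial>P)"
    unfolding levy_measure_def by (rule nn_integral_cong_AE)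
  with assms show False by simp
qed

end

section \<open>Summing over the cells of the grid\<close>

text \<open>One-sided limits bound the path near each point; compactness of the unit interval does
  the rest.\<close>

lemma cadlag_bdd_above:
  assumes "cadlag f"
  shows "bdd_above (f ` {0..1})"
proof -
  have "bdd_above (f ` ({0..1} \<inter> {0..1}))"
  proof (rule Bolzano[where P = "\<lambda>a b. bdd_above (f ` ({a..b} \<inter> {0..1}))"])
    fix a b c :: real
    assume *: "bdd_above (f ` ({a..b} \<inter> {0..1}))" "bdd_above (f ` ({b..c} \<inter> {0..1}))" "a \<le> b" "b \<le> c"
    have "{a..c} \<inter> {0..1} = ({a..b} \<inter> {0..1}) \<union> ({b..c} \<inter> {0..1})" using *(3,4) by auto
    then show "bdd_above (f ` ({a..c} \<inter> {0..1}))" using *(1,2) by (simp add: image_Un)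
  next
    fix x :: real assume x: "0 \<le> x" "x \<le> 1"
    obtain \<epsilon>1 where \<epsilon>1: "0 < \<epsilon>1" "\<And>v. x \<le> v \<Longrightarrow> v < x + \<epsilon>1 \<Longrightarrow> \<bar>f v - f x\<bar> < 1"
      using cadlag_right[OF assms x(1) zero_less_one] by blast
    \<comment> \<open>At \<open>x = 0\<close> there is no left limit to use; the guard
      \<open>0 \<le> v\<close> makes the claim vacuous there.\<close>
    obtain \<epsilon>2 where \<epsilon>2: "0 < \<epsilon>2" "\<And>v. x - \<epsilon>2 < v \<Longrightarrow> v < x \<Longrightarrow> 0 \<le> v \<Longrightarrow> \<bar>f v - Lim (at_left x) f\<bar> < 1"
    proof (cases "x = 0")
      case True
      then show ?thesis using that[of 1] by auto
    next
      case False
      then show ?thesis using cadlag_left[OF assms _ zero_less_one, of x] x that by (metis less_eq_real_def)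
    qed
    show "\<exists>d>0. \<forall>a b. a \<le> x \<and> x \<le> b \<and> b - a < d \<longrightarrow> bdd_above (f ` ({a..b} \<inter> {0..1}))"
    proof (rule exI[of _ "min \<epsilon>1 \<epsilon>2"], intro conjI allI impI)
      fix a b assume ab: "a \<le> x \<and> x \<le> b \<and> b - a < min \<epsilon>1 \<epsilon>2"
      have "f v \<le> max (f x) (Lim (at_left x) f) + 1" if "v \<in> {a..b} \<inter> {0..1}" for v
      proof (cases "v < x")
        case True
        have "\<bar>f v - Lim (at_left x) f\<bar> < 1" by (rule \<epsilon>2) (use that ab True in auto)
        then show ?thesis by linarith
      next
        case False
        have "\<bar>f v - f x\<bar> < 1" by (rule \<epsilon>1) (use that ab False in auto)
        then show ?thesis by linarith
      qed
      then show "bdd_above (f ` ({a..b} \<inter> {0..1}))" by (rule bdd_aboveI2)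
    qed (use \<epsilon>1 \<epsilon>2 in auto)
  qed simp
  then show ?thesis by simp
qed

text \<open>Reduces the supremum to countably many times: a strict exceedance before time 1 persists
  a little to the right, and time 1 is itself rational.\<close>

lemma cadlag_Sup_greater_iff:
  assumes f: "cadlag f"
  shows "(SUP t\<in>{0..1}. f t) > x \<longleftrightarrow> (\<exists>q\<in>\<rat> \<inter> {0..1}. f q > x)"
proof
  assume "(SUP t\<in>{0..1}. f t) > x"
  then obtain t where t: "t \<in> {0..1}" "f t > x"
    using less_cSUP_iff[of "{0..1}" f x] cadlag_bdd_above[OF f] by auto
  show "\<exists>q\<in>\<rat> \<inter> {0..1}. f q > x"
  proof (cases "t = 1")
    case False
    have "f t - x > 0" "0 \<le> t" using t by auto
    obtain \<epsilon> where \<epsilon>: "0 < \<epsilon>" "\<And>v. t \<le> v \<Longrightarrow> v < t + \<epsilon> \<Longrightarrow> \<bar>f v - f t\<bar> < f t - x"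
      using cadlag_right[OF f \<open>0 \<le> t\<close> \<open>f t - x > 0\<close>] by blast
    obtain q where q: "q \<in> \<rat>" "t < q" "q < min 1 (t + \<epsilon>)"
      using Rats_dense_in_real[of t "min 1 (t + \<epsilon>)"] t False \<epsilon>(1) by auto
    have "\<bar>f q - f t\<bar> < f t - x" by (rule \<epsilon>) (use q in auto)
    then show ?thesis using q t by (intro bexI[of _ q]) auto
  qed (use t in auto)
next
  assume "\<exists>q\<in>\<rat> \<inter> {0..1}. f q > x"
  then show "(SUP t\<in>{0..1}. f t) > x"
    using less_cSUP_iff[of "{0..1}" f x] cadlag_bdd_above[OF f] by auto
qed

text \<open>Lets probabilities in the completion be computed from a measurable event that agrees
  almost surely.\<close>

lemma sets_completion_of_AE_eq:
  assumes A: "A \<in> sets M" and B: "B \<subseteq> space M" and eq: "AE \<omega> in M. \<omega> \<in> B \<longleftrightarrow> \<omega> \<in> A"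
  shows "B \<in> sets (completion M)" "measure (completion M) B = measure M A"
proof -
  have "AE \<omega> in completion M. \<omega> \<in> B \<longleftrightarrow> \<omega> \<in> A" using eq by (rule AE_completion)
  then have N: "{\<omega> \<in> space M. \<not> (\<omega> \<in> B \<longleftrightarrow> \<omega> \<in> A)} \<in> null_sets (completion M)" (is "?N \<in> _")
    unfolding completion.AE_iff_null_sets space_completion .
  have BN: "B \<inter> ?N \<in> null_sets (completion M)" using N by (rule completion.complete2[rotated]) auto
  have B_eq: "(A - ?N) \<union> (B \<inter> ?N) = B" using B sets.sets_into_space[OF A] by auto
  have "A \<in> sets (completion M)" using A by simp
  then have "(A - ?N) \<union> (B \<inter> ?N) \<in> sets (completion M)"
    using null_setsD2[OF N] null_setsD2[OF BN] by (intro sets.Un sets.Diff)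
  then show *: "B \<in> sets (completion M)" by (simp only: B_eq)
  have "measure (completion M) B = measure (completion M) A"
    by (rule measure_eq_AE) (use * A \<open>AE \<omega> in completion M. _\<close> in auto)
  then show "measure (completion M) B = measure M A" using A by simp
qed

text \<open>Inside \<open>inc_path\<close> over a segment of length \<open>h\<close> this restricts
  only the total increment.\<close>

definition step_sets :: "real \<Rightarrow> real set \<Rightarrow> real \<Rightarrow> real set" where
  "step_sets h B v = (if v = h then B else UNIV)"

lemma mem_step_sets: "y \<in> step_sets h B v \<longleftrightarrow> (v = h \<longrightarrow> y \<in> B)"
  by (simp add: step_sets_def)

lemma step_sets_borel: "B \<in> sets borel \<Longrightarrow> step_sets h B v \<in> sets borel"
  by (simp add: step_sets_def)

section \<open>Exceedances at the midpoint of a single cell\<close>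

context levy_process
begin

lemma missed_exceedance_prob_eq:
  fixes x :: real
  assumes "n > 0"
  defines "A \<equiv> {\<omega> \<in> space P. (\<exists>q\<in>\<rat> \<inter> {0..1}. X q \<omega> > x) \<and> (\<forall>i\<le>n. X (real i / n) \<omega> \<le> x)}"
  shows "A \<in> sets P" "missed_exceedance_prob P X x n = prob A"
proof -
  have "A = (\<Union>q\<in>\<rat> \<inter> {0..1}. X q -` {x<..} \<inter> space P) \<inter> (\<Inter>i\<le>n. X (real i / n) -` {..x} \<inter> space P)"
    unfolding A_def by auto
  also have "\<dots> \<in> sets P"
  proof (rule sets.Int)
    have "countable (\<rat> \<inter> {0..1::real})" using countable_rat by (rule countable_subset[rotated]) auto
    then show "(\<Union>q\<in>\<rat> \<inter> {0..1}. X q -` {x<..} \<inter> space P) \<in> sets P"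
      by (intro sets.countable_UN') (auto intro!: measurable_sets[OF measurable_process])
    show "(\<Inter>i\<le>n. X (real i / n) -` {..x} \<inter> space P) \<in> sets P"
      by (intro sets.finite_INT measurable_sets[OF measurable_process]) auto
  qed
  finally show A: "A \<in> sets P" .
  have grid: "grid_max X n \<omega> \<le> x \<longleftrightarrow> (\<forall>i\<le>n. X (real i / n) \<omega> \<le> x)" for \<omega>
    unfolding grid_max_def by (subst Max_le_iff) auto
  have "AE \<omega> in P. \<omega> \<in> {\<omega> \<in> space P. sup_process X \<omega> > x \<and> grid_max X n \<omega> \<le> x} \<longleftrightarrow> \<omega> \<in> A"
    using cadlag_paths
  proof eventually_elim
    case (elim \<omega>)
    show ?case
      using cadlag_Sup_greater_iff[OF elim, of x] by (auto simp: A_def grid sup_process_def)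
  qed
  from sets_completion_of_AE_eq(2)[OF A _ this]
  show "missed_exceedance_prob P X x n = prob A"
    unfolding missed_exceedance_prob_def by blast
qed

text \<open>
  Used with \<open>B0 + B1 > x\<close> and \<open>B0 + B1 + B2 \<le> x - r\<close>: then among the multiples of \<open>h\<close> only the midpoint
  \<open>s + h\<close> of the cell \<open>[s, s + 2 h]\<close> sees a value above \<open>x\<close>.
\<close>

definition crossing_event ::
    "real \<Rightarrow> real \<Rightarrow> real set \<Rightarrow> real set \<Rightarrow> real set \<Rightarrow> real \<Rightarrow> real \<Rightarrow> 'a set" where
  "crossing_event x r B0 B1 B2 s h =
    inc_path 0 s (\<lambda>v. {..x} \<inter> step_sets s B0 v) \<inter> inc_path s h (step_sets h B1) \<inter>
    inc_path (s + h) h (step_sets h B2) \<inter> inc_path (s + h + h) (1 - (s + h + h)) (\<lambda>_. {..r})"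

text \<open>Splits off the last of the four segments repeatedly; each remaining intersection is
  again an event of the past.\<close>

lemma crossing_event_prob:
  assumes B: "B0 \<in> sets borel" "B1 \<in> sets borel" "B2 \<in> sets borel"
    and s: "s \<in> \<rat>" "0 \<le> s" and h: "h \<in> \<rat>" "0 \<le> h" and le: "s + h + h \<le> 1"
  shows "crossing_event x r B0 B1 B2 s h \<in> sets P"
    and "prob (crossing_event x r B0 B1 B2 s h) =
      prob (inc_path 0 s (\<lambda>v. {..x} \<inter> step_sets s B0 v)) * prob (inc_path 0 h (step_sets h B1)) *
      prob (inc_path 0 h (step_sets h B2)) * prob (inc_path 0 (1 - (s + h + h)) (\<lambda>_. {..r}))"
proof -
  note [simp] = step_sets_borel B
  define A0 where "A0 = inc_path 0 s (\<lambda>v. {..x} \<inter> step_sets s B0 v)"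
  define A1 where "A1 = A0 \<inter> inc_path s h (step_sets h B1)"
  define A2 where "A2 = A1 \<inter> inc_path (s + h) h (step_sets h B2)"
  have eq: "crossing_event x r B0 B1 B2 s h = A2 \<inter> inc_path (s + h + h) (1 - (s + h + h)) (\<lambda>_. {..r})"
    by (simp add: crossing_event_def A0_def A1_def A2_def)
  show "crossing_event x r B0 B1 B2 s h \<in> sets P"
    unfolding crossing_event_def using s h by (intro sets.Int inc_path_sets) auto
  have 0: "past s A0" unfolding A0_def by (rule past_inc_path) auto
  have 1: "past (s + h) A1" unfolding A1_def using s h by (intro past_Int_inc_path 0) auto
  have 2: "past (s + h + h) A2" unfolding A2_def using s h by (intro past_Int_inc_path 1) auto
  have "prob A1 = prob A0 * prob (inc_path 0 h (step_sets h B1))"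
    unfolding A1_def using s h by (intro past_mult 0) auto
  moreover have "prob A2 = prob A1 * prob (inc_path 0 h (step_sets h B2))"
    unfolding A2_def using s h by (intro past_mult 1) auto
  moreover have "prob (crossing_event x r B0 B1 B2 s h) = prob A2 * prob (inc_path 0 (1 - (s + h + h)) (\<lambda>_. {..r}))"
    unfolding eq using s h le by (intro past_mult 2) auto
  ultimately show "prob (crossing_event x r B0 B1 B2 s h) =
      prob (inc_path 0 s (\<lambda>v. {..x} \<inter> step_sets s B0 v)) * prob (inc_path 0 h (step_sets h B1)) *
      prob (inc_path 0 h (step_sets h B2)) * prob (inc_path 0 (1 - (s + h + h)) (\<lambda>_. {..r}))"
    by (simp add: A0_def)
qed

text \<open>After the cell the path starts at a level of at most \<open>x - r\<close> and gains at
  most \<open>r\<close>.\<close>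

lemma crossing_eventD:
  assumes \<omega>: "\<omega> \<in> crossing_event x r B0 B1 B2 s h"
    and conf: "\<And>y u d. y \<in> B0 \<Longrightarrow> u \<in> B1 \<Longrightarrow> d \<in> B2 \<Longrightarrow> y + u > x \<and> y + u + d \<le> x - r"
    and s: "s \<in> \<rat>" "0 \<le> s" and h: "h \<in> \<rat>" "0 \<le> h" and le: "s + h + h \<le> 1"
  shows "X (s + h) \<omega> - X 0 \<omega> > x"
    and "\<And>v. v \<in> \<rat> \<Longrightarrow> 0 \<le> v \<Longrightarrow> v \<le> 1 \<Longrightarrow> v \<le> s \<or> s + h + h \<le> v \<Longrightarrow> X v \<omega> - X 0 \<omega> \<le> x"
proof -
  have inc: "X (s' + v) \<omega> - X s' \<omega> \<in> D v"
    if "\<omega> \<in> inc_path s' T D" "v \<in> \<rat>" "0 \<le> v" "v \<le> T" for s' T D v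
    using that by (simp add: inc_path_def)
  have pre: "X v \<omega> - X 0 \<omega> \<in> {..x} \<inter> step_sets s B0 v" if "v \<in> \<rat>" "0 \<le> v" "v \<le> s" for v
    using \<omega> that by (auto simp: crossing_event_def inc_path_def)
  have y: "X s \<omega> - X 0 \<omega> \<in> B0" using pre[of s] s by (simp add: step_sets_def)
  have "X (s + h) \<omega> - X s \<omega> \<in> step_sets h B1 h"
    by (rule inc[of s h]) (use \<omega> h in \<open>auto simp: crossing_event_def\<close>)
  then have u: "X (s + h) \<omega> - X s \<omega> \<in> B1" by (simp add: step_sets_def)
  have "X (s + h + h) \<omega> - X (s + h) \<omega> \<in> step_sets h B2 h"
    by (rule inc[of "s + h" h]) (use \<omega> h in \<open>auto simp: crossing_event_def\<close>)
  then have d: "X (s + h + h) \<omega> - X (s + h) \<omega> \<in> B2" by (simp add: step_sets_def)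
  from conf[OF y u d] show "X (s + h) \<omega> - X 0 \<omega> > x" by simp
  fix v assume v: "v \<in> \<rat>" "0 \<le> v" "v \<le> 1" "v \<le> s \<or> s + h + h \<le> v"
  show "X v \<omega> - X 0 \<omega> \<le> x"
  proof (cases "v \<le> s")
    case True
    then show ?thesis using pre v by auto
  next
    case False
    define w where "w = v - (s + h + h)"
    have w: "w \<in> \<rat> \<inter> {0..1 - (s + h + h)}" using v False s h by (auto simp: w_def)
    have "X (s + h + h + w) \<omega> - X (s + h + h) \<omega> \<in> {..r}"
      by (rule inc[of "s + h + h" "1 - (s + h + h)"]) (use \<omega> w in \<open>auto simp: crossing_event_def\<close>)
    then show ?thesis using conf[OF y u d] by (simp add: w_def)
  qed
qed

text \<open>The event in \<open>pre\<close> keeps the level in \<open>B0\<close> throughout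
  \<open>[t0, t1]\<close> and so serves all cells starting there. There are of order
  \<open>n\<close> such cells; each has a crossing event of probability at least of order
  \<open>1 / n^2\<close>, and these events are disjoint.\<close>

lemma missed_exceedance_liminf_pos:
  assumes t: "t1 \<in> \<rat>" "0 \<le> t0" "t0 < t1" "t1 \<le> 1 / 2"
    and B: "B0 \<in> sets borel" "B1 \<in> sets borel" "B2 \<in> sets borel"
    and pre: "prob (inc_path 0 t1 (\<lambda>v. {..x} \<inter> (if t0 \<le> v then B0 else UNIV))) > 0"
    and up: "c1 > 0" "\<forall>\<^sub>F N in sequentially. prob (inc_path 0 (1 / real N) (step_sets (1 / real N) B1)) \<ge> c1 / real N"
    and down: "c2 > 0" "\<forall>\<^sub>F N in sequentially. prob (inc_path 0 (1 / real N) (step_sets (1 / real N) B2)) \<ge> c2 / real N"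
    and post: "prob (inc_path 0 1 (\<lambda>_. {..r})) > 0"
    and conf: "\<And>y u d. y \<in> B0 \<Longrightarrow> u \<in> B1 \<Longrightarrow> d \<in> B2 \<Longrightarrow> y + u > x \<and> y + u + d \<le> x - r"
  shows "liminf (\<lambda>n. ereal (real n * missed_exceedance_prob P X x n)) > 0"
proof -
  define c0 where "c0 = prob (inc_path 0 t1 (\<lambda>v. {..x} \<inter> (if t0 \<le> v then B0 else UNIV)))"
  define c3 where "c3 = prob (inc_path 0 1 (\<lambda>_. {..r}))"
  have c0: "c0 > 0" and c3: "c3 > 0" using pre post by (simp_all add: c0_def c3_def)
  \<comment> \<open>The factor \<open>(t1 - t0) / 2\<close> comes from the number of cells, the 4
    from two steps of length \<open>1 / (2 * n)\<close>.\<close>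
  define K where "K = (t1 - t0) / 2 * c0 * c1 * c2 * c3 / 4"
  have K: "K > 0" using t up down c0 c3 by (simp add: K_def)
  obtain n0 where n0: "\<And>N. N \<ge> n0 \<Longrightarrow> prob (inc_path 0 (1 / real N) (step_sets (1 / real N) B1)) \<ge> c1 / real N"
    "\<And>N. N \<ge> n0 \<Longrightarrow> prob (inc_path 0 (1 / real N) (step_sets (1 / real N) B2)) \<ge> c2 / real N"
    using eventually_conj[OF up(2) down(2)] unfolding eventually_sequentially by blast
  obtain m :: nat where m: "\<And>N. N \<ge> m \<Longrightarrow> 1 / real N < (t1 - t0) / 2"
    using inverse_nat_eventually_less[of "(t1 - t0) / 2"] t by auto
  have "K \<le> real n * missed_exceedance_prob P X x n" if n: "n \<ge> max (max n0 m) 2" for n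
  proof -
    \<comment> \<open>Half a cell, so that the step bounds are used on the grid with
      \<open>2 * n\<close> cells.\<close>
    define h where "h = 1 / real (2 * n)"
    define F where "F i = crossing_event x r B0 B1 B2 (real i / n) h" for i :: nat
    define I where "I = {nat \<lceil>t0 * n\<rceil>..nat \<lfloor>t1 * n\<rfloor>}"
    define A where "A = {\<omega> \<in> space P. (\<exists>q\<in>\<rat> \<inter> {0..1}. X q \<omega> > x) \<and> (\<forall>i\<le>n. X (real i / n) \<omega> \<le> x)}"
    have "n > 0" using n by simp
    have A_sets: "A \<in> sets P" and A_prob: "missed_exceedance_prob P X x n = prob A"
      unfolding A_def by (fact missed_exceedance_prob_eq[OF \<open>n > 0\<close>])+
    have h: "h \<in> \<rat>" "0 \<le> h" "h + h = 1 / real n" using \<open>n > 0\<close> by (auto simp: h_def intro: Rats_divide)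
    have rat: "real i / real n \<in> \<rat>" for i by (intro Rats_divide Rats_of_nat)
    have s2: "real i / n + h + h = real (Suc i) / n" for i using h(3) by (simp add: add_divide_distrib)
    have I: "t0 \<le> real i / n" "real i / n \<le> t1" "real i / n + h + h \<le> 1" if "i \<in> I" for i
    proof -
      have t0n: "0 \<le> t0 * n" "0 \<le> t1 * n" using t by auto
      have "real i \<ge> t0 * n" using that by (simp add: I_def; linarith)
      then show "t0 \<le> real i / n" using \<open>n > 0\<close> by (simp add: field_simps)
      have "real i \<le> t1 * n" using that t0n by (simp add: I_def; linarith)
      then show "real i / n \<le> t1" using \<open>n > 0\<close> by (simp add: field_simps)
      then have "real i / n + h + h \<le> 1 / 2 + 1 / n" using t h by linarith
      also have "1 / real n \<le> 1 / 2" using n by (intro divide_left_mono) auto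
      finally show "real i / n + h + h \<le> 1" by simp
    qed
    \<comment> \<open>Rounding loses at most 1, which for these \<open>n\<close> is at most half of
      \<open>(t1 - t0) * n\<close>.\<close>
    have card_I: "real (card I) \<ge> (t1 - t0) / 2 * n"
    proof -
      have "1 / real n < (t1 - t0) / 2" using m n by auto
      then have "1 \<le> (t1 - t0) / 2 * n" using \<open>n > 0\<close> by (simp add: field_simps)
      moreover have "t1 * n - t0 * n = (t1 - t0) / 2 * n + (t1 - t0) / 2 * n" by (simp add: field_simps)
      ultimately have "(t1 - t0) / 2 * n \<le> t1 * n - t0 * n - 1" by linarith
      also have "\<dots> \<le> real (card I)"
      proof -
        have "0 \<le> t0 * n" "0 \<le> t1 * n" using t by auto
        then have "real (nat \<lceil>t0 * n\<rceil>) \<le> t0 * n + 1" "t1 * n - 1 \<le> real (nat \<lfloor>t1 * n\<rfloor>)" by linarith+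
        moreover have "real (nat \<lfloor>t1 * n\<rfloor>) + 1 - real (nat \<lceil>t0 * n\<rceil>) \<le> real (card I)"
          unfolding I_def card_atLeastAtMost by linarith
        ultimately show ?thesis by linarith
      qed
      finally show ?thesis .
    qed
    have F_sets: "F i \<in> sets P" if "i \<in> I" for i
      unfolding F_def using B rat h I[OF that] by (intro crossing_event_prob(1)) auto
    have F_prob: "prob (F i) \<ge> c0 * (c1 / (2 * n)) * (c2 / (2 * n)) * c3" if "i \<in> I" for i
    proof -
      have a: "c0 \<le> prob (inc_path 0 (real i / n) (\<lambda>v. {..x} \<inter> step_sets (real i / n) B0 v))"
        unfolding c0_def
      proof (intro finite_measure_mono inc_path_mono inc_path_sets)
        fix v assume "0 \<le> v" "v \<le> real i / n"
        show "{..x} \<inter> (if t0 \<le> v then B0 else UNIV) \<subseteq> {..x} \<inter> step_sets (real i / n) B0 v"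
          using I[OF that] by (auto simp: step_sets_def)
      qed (use I[OF that] B in \<open>auto simp: step_sets_borel\<close>)
      have b: "c1 / (2 * n) \<le> prob (inc_path 0 h (step_sets h B1))"
        using n0(1)[of "2 * n"] n by (simp add: h_def)
      have c: "c2 / (2 * n) \<le> prob (inc_path 0 h (step_sets h B2))"
        using n0(2)[of "2 * n"] n by (simp add: h_def)
      have d: "c3 \<le> prob (inc_path 0 (1 - (real i / n + h + h)) (\<lambda>_. {..r}))"
      proof -
        have "0 \<le> real i / n" by simp
        then have "1 - (real i / n + h + h) \<le> 1" using h(2) by linarith
        then show ?thesis
          unfolding c3_def by (intro finite_measure_mono inc_path_mono inc_path_sets) auto
      qed
      have "prob (F i) = prob (inc_path 0 (real i / n) (\<lambda>v. {..x} \<inter> step_sets (real i / n) B0 v)) * prob (inc_path 0 h (step_sets h B1)) *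
        prob (inc_path 0 h (step_sets h B2)) * prob (inc_path 0 (1 - (real i / n + h + h)) (\<lambda>_. {..r}))"
        unfolding F_def using B rat h I[OF that] by (intro crossing_event_prob(2)) auto
      also have "\<dots> \<ge> c0 * (c1 / (2 * n)) * (c2 / (2 * n)) * c3"
        using c0 c3 up(1) down(1) by (intro mult_mono a b c d mult_nonneg_nonneg) auto
      finally show ?thesis .
    qed
    note D = crossing_eventD[OF _ conf rat _ h(1,2), where ?B0.0 = B0 and ?B1.0 = B1 and ?B2.0 = B2]
    have F_le: "X v \<omega> - X 0 \<omega> \<le> x"
      if "\<omega> \<in> F i" "i \<in> I" "v \<in> \<rat>" "0 \<le> v" "v \<le> 1" "v \<le> real i / n \<or> real (Suc i) / n \<le> v" for i v \<omega>
      using D(2)[of \<omega> i v] that I[OF that(2)] unfolding F_def s2 by auto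
    have F_gt: "X (real i / n + h) \<omega> - X 0 \<omega> > x" if "\<omega> \<in> F i" "i \<in> I" for i \<omega>
      using D(1)[of \<omega> i] that I[OF that(2)] unfolding F_def by auto
    \<comment> \<open>On the event of a later cell \<open>j\<close> all rational times up to
      \<open>j / n\<close> stay at or below \<open>x\<close>, among them the midpoint of the earlier
      cell \<open>i\<close>, where the event of cell \<open>i\<close> exceeds
      \<open>x\<close>.\<close>
    have disj: "disjoint_family_on F I"
      unfolding disjoint_family_on_def
    proof (intro ballI impI)
      fix i j assume ij: "i \<in> I" "j \<in> I" "i \<noteq> j"
      have "F i \<inter> F j = {}" if "i < j" "i \<in> I" "j \<in> I" for i j
      proof -
        have "real (Suc i) / n \<le> real j / n" using that by (intro divide_right_mono) auto
        then have "real i / n + h \<le> real j / n" using s2[of i] h(2) by linarith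
        moreover have "real i / n + h \<in> \<rat>" "0 \<le> real i / n + h" "real i / n + h \<le> 1"
          using rat h I[OF that(2)] by auto
        ultimately show ?thesis
          using F_gt[OF _ that(2)] F_le[OF _ that(3)] by (meson disjoint_iff linorder_not_le)
      qed
      then show "F i \<inter> F j = {}" using ij by (metis Int_commute linorder_neqE_nat)
    qed
    \<comment> \<open>The crossing events speak of increments from time 0; \<open>X 0 = 0\<close>
      almost surely turns these into values.\<close>
    have "AE \<omega> in P. \<omega> \<in> (\<Union>i\<in>I. F i) \<longrightarrow> \<omega> \<in> A"
      using start_zero AE_space
    proof eventually_elim
      case (elim \<omega>)
      show ?case
      proof
        assume "\<omega> \<in> (\<Union>i\<in>I. F i)"
        then obtain i where i: "i \<in> I" "\<omega> \<in> F i" by blast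
        have "real i / n + h \<in> \<rat> \<inter> {0..1}" using rat h I[OF i(1)] by auto
        then have "\<exists>q\<in>\<rat> \<inter> {0..1}. X q \<omega> > x" using F_gt[OF i(2,1)] elim by auto
        moreover have "X (real j / n) \<omega> \<le> x" if "j \<le> n" for j
        proof -
          have "real j / n \<le> 1" using that \<open>n > 0\<close> by simp
          moreover have "real j / n \<le> real i / n \<or> real (Suc i) / n \<le> real j / n"
            using divide_right_mono[of "real j" "real i" "real n"] divide_right_mono[of "real (Suc i)" "real j" "real n"]
            by (metis le_SucE not_less_eq_eq of_nat_0_le_iff of_nat_le_iff linorder_not_le Suc_leI)
          ultimately show ?thesis using F_le[OF i(2,1) rat, of j] elim by simp
        qed
        ultimately show "\<omega> \<in> A" using elim by (simp add: A_def)
      qed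
    qed
    then have "prob (\<Union>i\<in>I. F i) \<le> prob A"
      using A_sets by (rule finite_measure_mono_AE)
    moreover have "prob (\<Union>i\<in>I. F i) = (\<Sum>i\<in>I. prob (F i))"
      using F_sets disj by (intro finite_measure_finite_Union) (auto simp: I_def)
    moreover have "(\<Sum>i\<in>I. prob (F i)) \<ge> real (card I) * (c0 * (c1 / (2 * n)) * (c2 / (2 * n)) * c3)"
      using F_prob by (rule sum_bounded_below)
    moreover have "real (card I) * (c0 * (c1 / (2 * n)) * (c2 / (2 * n)) * c3)
        \<ge> ((t1 - t0) / 2 * n) * (c0 * (c1 / (2 * n)) * (c2 / (2 * n)) * c3)"
      using card_I c0 c3 up(1) down(1) by (intro mult_right_mono) auto
    ultimately have "((t1 - t0) / 2 * n) * (c0 * (c1 / (2 * n)) * (c2 / (2 * n)) * c3) \<le> prob A"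
      by linarith
    then have "real n * (((t1 - t0) / 2 * n) * (c0 * (c1 / (2 * n)) * (c2 / (2 * n)) * c3)) \<le> real n * prob A"
      by (rule mult_left_mono) simp
    moreover have "real n * (((t1 - t0) / 2 * n) * (c0 * (c1 / (2 * n)) * (c2 / (2 * n)) * c3)) = K"
      using \<open>n > 0\<close> by (simp add: K_def field_simps)
    ultimately have "K \<le> real n * prob A" by linarith
    then show ?thesis
      by (simp add: A_prob)
  qed
  then have "\<forall>\<^sub>F n in sequentially. ereal K \<le> ereal (real n * missed_exceedance_prob P X x n)"
    unfolding eventually_sequentially by (intro exI[of _ "max (max n0 m) 2"]) auto
  then have "ereal K \<le> liminf (\<lambda>n. ereal (real n * missed_exceedance_prob P X x n))"
    by (rule Liminf_bounded)
  moreover have "0 < ereal K" using K by simp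
  ultimately show ?thesis by (rule less_le_trans[rotated])
qed

end

section \<open>Reachable levels\<close>

lemma closed_walk_nat:
  fixes R :: "real set"
  assumes "\<And>j. j < n \<Longrightarrow> y + real j * a \<in> R \<Longrightarrow> y + real (Suc j) * a \<in> R" "y \<in> R" "j \<le> n"
  shows "y + real j * a \<in> R"
  using \<open>j \<le> n\<close>
proof (induction j)
  case (Suc j)
  then show ?case using assms(1)[of j] by simp
qed (use assms(2) in simp)

lemma ex_nat_mult_ge:
  fixes a c :: real
  assumes "a > 0"
  shows "\<exists>p::nat. c \<le> real p * a"
proof -
  obtain p :: nat where "c / a < real p" using reals_Archimedean2 by blast
  then show ?thesis using assms by (intro exI[of _ p]) (simp add: field_simps)
qed

text \<open>Climb from \<open>y\<close> by \<open>a\<close> to the first level of at least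
  \<open>x - a\<close>, then descend by \<open>b\<close>. The open window has length
  \<open>b\<close>, so a descent can avoid it only by landing exactly on \<open>x - a\<close>.
  Solving for \<open>y\<close> gives the formula, with bounds on both step counts.\<close>

lemma walk_avoiding_window:
  fixes R :: "real set"
  assumes a: "a > 0" and b: "b > 0" and R: "\<And>y. y \<in> R \<Longrightarrow> y < x"
    and up: "\<And>y. y \<in> R \<Longrightarrow> y + a < x \<Longrightarrow> y + a \<in> R"
    and down: "\<And>y. y \<in> R \<Longrightarrow> y - b \<in> R"
    and avoid: "\<And>y. y \<in> R \<Longrightarrow> \<not> (x - a < y \<and> y < x - a + b)"
    and y: "y \<in> R"
  shows "\<exists>p q::nat. y = x - real (Suc p) * a + real q * b \<and> real p * a \<le> x - y \<and> real q * b \<le> a"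
proof -
  define p where "p = (LEAST p::nat. y + real p * a \<ge> x - a)"
  have "\<exists>p::nat. y + real p * a \<ge> x - a" using ex_nat_mult_ge[OF a, of "x - a - y"] by (auto simp: algebra_simps)
  then have p: "y + real p * a \<ge> x - a" unfolding p_def by (rule LeastI_ex)
  have p': "y + real j * a < x - a" if "j < p" for j
    using not_less_Least[of j] that unfolding p_def by (metis linorder_not_le)
  have z: "y + real p * a \<in> R"
  proof (rule closed_walk_nat[where n = p])
    fix j assume "j < p" "y + real j * a \<in> R"
    then show "y + real (Suc j) * a \<in> R" using up[of "y + real j * a"] p'[of j] by (simp add: algebra_simps)
  qed (use y in auto)
  have pa: "real p * a \<le> x - y"
    using R[OF z] by simp
  define z where "z = y + real p * a"
  define q where "q = (LEAST q::nat. z - real q * b < x - a + b)"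
  have "\<exists>q::nat. z - real q * b < x - a + b"
  proof -
    obtain q :: nat where "z - (x - a) \<le> real q * b" using ex_nat_mult_ge[OF b] by blast
    then show ?thesis using b by (intro exI[of _ q]) linarith
  qed
  then have q: "z - real q * b < x - a + b" unfolding q_def by (rule LeastI_ex)
  have q': "z - real j * b \<ge> x - a + b" if "j < q" for j
    using not_less_Least[of j] that unfolding q_def by (metis linorder_not_le)
  have zR: "z + real q * (- b) \<in> R"
  proof (rule closed_walk_nat[where n = q])
    fix j assume "z + real j * (- b) \<in> R"
    from down[OF this] show "z + real (Suc j) * (- b) \<in> R" by (simp add: algebra_simps)
  qed (use \<open>y + real p * a \<in> R\<close> in \<open>auto simp: z_def\<close>)
  \<comment> \<open>One step before stopping the walk was still at least \<open>x - a + b\<close>.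
    So the last step does not fall below \<open>x - a\<close>, and together with
    \<open>z < x\<close> the whole descent is at most \<open>a\<close>.\<close>
  have zge: "z - real q * b \<ge> x - a \<and> real q * b \<le> a"
  proof (cases q)
    case 0
    then show ?thesis using p a by (simp add: z_def)
  next
    case (Suc j)
    have "z - real j * b \<ge> x - a + b" using q'[of j] Suc by simp
    moreover have "z < x" using R \<open>y + real p * a \<in> R\<close> by (simp add: z_def)
    moreover have "real q * b = real j * b + b" by (simp add: Suc algebra_simps)
    ultimately show ?thesis by linarith
  qed
  have "z - real q * b = x - a" using avoid[OF zR] zge q by simp
  then have "y = x - real (Suc p) * a + real q * b" by (simp add: z_def algebra_simps)
  then show ?thesis using pa zge by blast
qed

text \<open>Above \<open>z - 1\<close> the two step counts of an avoiding walk are bounded, so only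
  finitely many levels are left there.\<close>

lemma walk_avoiding_window_isolated:
  fixes R :: "real set"
  assumes a: "a > 0" and b: "b > 0" and R: "\<And>y. y \<in> R \<Longrightarrow> y < x"
    and up: "\<And>y. y \<in> R \<Longrightarrow> y + a < x \<Longrightarrow> y + a \<in> R"
    and down: "\<And>y. y \<in> R \<Longrightarrow> y - b \<in> R"
    and avoid: "\<And>y. y \<in> R \<Longrightarrow> \<not> (x - a < y \<and> y < x - a + b)"
  shows "\<exists>\<eta>>0. \<forall>y\<in>R. \<bar>y - z\<bar> < \<eta> \<longrightarrow> y = z"
proof -
  define S where "S = R \<inter> {z - 1<..}"
  obtain P :: nat where P: "(x - z + 1) \<le> real P * a" using ex_nat_mult_ge[OF a] by blast
  obtain Q :: nat where Q: "a \<le> real Q * b" using ex_nat_mult_ge[OF b] by blast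
  have "S \<subseteq> (\<lambda>(p, q). x - real (Suc p) * a + real q * b) ` ({..P} \<times> {..Q})"
  proof
    fix y assume "y \<in> S"
    then have y: "y \<in> R" "z - 1 < y" by (auto simp: S_def)
    obtain p q :: nat where pq: "y = x - real (Suc p) * a + real q * b" "real p * a \<le> x - y" "real q * b \<le> a"
      using walk_avoiding_window[OF a b R up down avoid y(1)] by blast
    have "real p * a \<le> real P * a" "real q * b \<le> real Q * b" using pq P Q y by linarith+
    then have "p \<le> P" "q \<le> Q" using a b by simp_all
    then show "y \<in> (\<lambda>(p, q). x - real (Suc p) * a + real q * b) ` ({..P} \<times> {..Q})"
      using pq(1) by (auto intro!: image_eqI[of _ _ "(p, q)"])
  qed
  then have "finite S" by (rule finite_subset) auto
  from finite_set_avoid[OF this, of z] obtain d where d: "d > 0" "\<And>y. y \<in> S \<Longrightarrow> y \<noteq> z \<Longrightarrow> d \<le> dist z y" by blast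
  show ?thesis
  proof (intro exI[of _ "min d 1"] conjI ballI impI)
    fix y assume y: "y \<in> R" "\<bar>y - z\<bar> < min d 1"
    then have "y \<in> S" by (auto simp: S_def)
    show "y = z"
    proof (rule ccontr)
      assume "y \<noteq> z"
      from d(2)[OF \<open>y \<in> S\<close> this] y(2) show False by (simp add: dist_real_def abs_minus_commute)
    qed
  qed (use d in auto)
qed

text \<open>Exact hits are allowed here. Climb until one more up-step would exceed \<open>x\<close>,
  then descend until \<open>y + a - b \<le> x\<close>. That the walk did not stop one level higher
  says precisely \<open>y + a > x\<close>.\<close>

lemma walk_reaches_window:
  fixes R :: "real set"
  assumes a: "a > 0" and b: "b > 0" and x: "x \<ge> 0" "0 \<in> R" and R: "\<And>y. y \<in> R \<Longrightarrow> y \<le> x"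
    and up: "\<And>y. y \<in> R \<Longrightarrow> y + a \<le> x \<Longrightarrow> y + a \<in> R"
    and down: "\<And>y. y \<in> R \<Longrightarrow> y - b \<in> R"
  shows "\<exists>y\<in>R. y + a > x \<and> y + a - b \<le> x"
proof -
  define p where "p = (LEAST p::nat. real p * a > x - a)"
  have "\<exists>p::nat. real p * a > x - a" using ex_nat_mult_ge[OF a, of x] a by (metis add.commute diff_less_eq less_add_same_cancel1 order_le_less_trans)
  then have p: "real p * a > x - a" unfolding p_def by (rule LeastI_ex)
  have p': "real j * a \<le> x - a" if "j < p" for j
    using not_less_Least[of j] that unfolding p_def by (metis linorder_not_le)
  have z: "0 + real p * a \<in> R"
  proof (rule closed_walk_nat[where n = p])
    fix j assume "j < p" "0 + real j * a \<in> R"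
    then show "0 + real (Suc j) * a \<in> R" using up[of "real j * a"] p'[of j] by (simp add: algebra_simps)
  qed (use x in auto)
  define z where "z = real p * a"
  define q where "q = (LEAST q::nat. z + a - b - real q * b \<le> x)"
  have "\<exists>q::nat. z + a - b - real q * b \<le> x"
  proof -
    obtain q :: nat where "z + a - b - x \<le> real q * b" using ex_nat_mult_ge[OF b] by blast
    then show ?thesis by (intro exI[of _ q]) linarith
  qed
  then have q: "z + a - b - real q * b \<le> x" unfolding q_def by (rule LeastI_ex)
  have q': "z + a - b - real j * b > x" if "j < q" for j
    using not_less_Least[of j] that unfolding q_def by (metis linorder_not_le)
  have zR: "z + real q * (- b) \<in> R"
  proof (rule closed_walk_nat[where n = q])
    fix j assume "z + real j * (- b) \<in> R"
    from down[OF this] show "z + real (Suc j) * (- b) \<in> R" by (simp add: algebra_simps)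
  qed (use z in \<open>auto simp: z_def\<close>)
  have "z - real q * b + a > x"
  proof (cases q)
    case 0
    then show ?thesis using p by (simp add: z_def)
  next
    case (Suc j)
    then show ?thesis using q'[of j] by (simp add: algebra_simps)
  qed
  then show ?thesis using zR q by (intro bexI[OF _ zR]) (auto simp: algebra_simps)
qed

section \<open>Walks realised by paths with positive probability\<close>

context levy_process
begin

text \<open>Joins independent segments. The common time \<open>s\<close> counts as time 0 of the
  second one, hence \<open>v < s\<close> in the condition on the first.\<close>

lemma inc_path_concat_pos:
  assumes s: "s \<in> \<rat>" "0 \<le> s" and T: "T \<in> \<rat>" "0 \<le> T"
    and borel: "\<And>v. D v \<in> sets borel" "\<And>v. E v \<in> sets borel" "\<And>v. G v \<in> sets borel"
    and pos: "prob (inc_path 0 s D) > 0" "prob (inc_path 0 T E) > 0"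
    and 1: "\<And>v y. 0 \<le> v \<Longrightarrow> v < s \<Longrightarrow> y \<in> D v \<Longrightarrow> y \<in> G v"
    and 2: "\<And>v y z. 0 \<le> v \<Longrightarrow> v \<le> T \<Longrightarrow> y \<in> D s \<Longrightarrow> z \<in> E v \<Longrightarrow> y + z \<in> G (s + v)"
  shows "prob (inc_path 0 (s + T) G) > 0"
proof -
  have "inc_path 0 s D \<inter> inc_path s T E \<subseteq> inc_path 0 (s + T) G"
  proof
    fix \<omega> assume *: "\<omega> \<in> inc_path 0 s D \<inter> inc_path s T E"
    have D: "X v \<omega> - X 0 \<omega> \<in> D v" if "v \<in> \<rat>" "0 \<le> v" "v \<le> s" for v
      using * that by (auto simp: inc_path_def)
    have E: "X (s + v) \<omega> - X s \<omega> \<in> E v" if "v \<in> \<rat>" "0 \<le> v" "v \<le> T" for v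
      using * that by (auto simp: inc_path_def)
    have "X v \<omega> - X 0 \<omega> \<in> G v" if v: "v \<in> \<rat>" "0 \<le> v" "v \<le> s + T" for v
    proof (cases "v < s")
      case True
      then show ?thesis using D 1 v by auto
    next
      case False
      then have "(X s \<omega> - X 0 \<omega>) + (X (s + (v - s)) \<omega> - X s \<omega>) \<in> G (s + (v - s))"
        using v s by (intro 2 D E) auto
      then show ?thesis by simp
    qed
    then show "\<omega> \<in> inc_path 0 (s + T) G" using * by (auto simp: inc_path_def)
  qed
  then have "prob (inc_path 0 s D \<inter> inc_path s T E) \<le> prob (inc_path 0 (s + T) G)"
    using borel s by (intro finite_measure_mono inc_path_sets) auto
  moreover have "prob (inc_path 0 s D \<inter> inc_path s T E) > 0"
    using pos past_mult[OF past_inc_path s T, of D E] borel by simp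
  ultimately show ?thesis by linarith
qed

lemma inc_path_prob_mono:
  assumes "T' \<le> T" "\<And>v. 0 \<le> v \<Longrightarrow> v \<le> T' \<Longrightarrow> D v \<subseteq> D' v" "\<And>v. D' v \<in> sets borel"
  shows "prob (inc_path 0 T D) \<le> prob (inc_path 0 T' D')"
  using assms by (intro finite_measure_mono inc_path_mono inc_path_sets) auto

text \<open>Chains \<open>N\<close> independent blocks: \<open>A\<close> confines the path, and
  \<open>B\<close> is where each block must end so that the next one stays inside
  \<open>A\<close>.\<close>

lemma inc_path_iterate_pos:
  assumes N: "N > 0" and borel: "A \<in> sets borel" "B \<in> sets borel"
    and pos: "prob (inc_path 0 (1 / real N) (\<lambda>v. A \<inter> step_sets (1 / real N) B v)) > 0"
    and 0: "0 \<in> A" "0 \<in> B" and BA: "\<And>y z. y \<in> B \<Longrightarrow> z \<in> A \<Longrightarrow> y + z \<in> A"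
    and BB: "\<And>y z. y \<in> B \<Longrightarrow> z \<in> B \<Longrightarrow> y + z \<in> B"
  shows "prob (inc_path 0 1 (\<lambda>_. A)) > 0"
proof -
  have "prob (inc_path 0 (real k / N) (\<lambda>v. A \<inter> step_sets (real k / N) B v)) > 0" for k :: nat
  proof (induction k)
    case 0
    have "inc_path 0 (real 0 / N) (\<lambda>v. A \<inter> step_sets (real 0 / N) B v) = space P"
      using \<open>0 \<in> A\<close> \<open>0 \<in> B\<close> by (auto simp: inc_path_def step_sets_def)
    then show ?case by (simp add: prob_space)
  next
    case (Suc k)
    have eq: "real k / N + 1 / N = real (Suc k) / N" by (simp add: add_divide_distrib)
    have "prob (inc_path 0 (real k / N + 1 / N) (\<lambda>v. A \<inter> step_sets (real (Suc k) / N) B v)) > 0"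
    proof (rule inc_path_concat_pos[OF _ _ _ _ _ _ _ Suc pos])
      fix v y assume "0 \<le> v" "v < real k / real N" "y \<in> A \<inter> step_sets (real k / real N) B v"
      then show "y \<in> A \<inter> step_sets (real (Suc k) / real N) B v"
        using eq N by (auto simp: step_sets_def divide_less_cancel)
    next
      fix v y z assume *: "0 \<le> v" "v \<le> 1 / real N" "y \<in> A \<inter> step_sets (real k / real N) B (real k / real N)"
        "z \<in> A \<inter> step_sets (1 / real N) B v"
      have "z \<in> B" if "real k / N + v = real (Suc k) / N"
      proof -
        have "v = 1 / N" using that eq by linarith
        then show ?thesis using * by (simp add: step_sets_def)
      qed
      then show "y + z \<in> A \<inter> step_sets (real (Suc k) / real N) B (real k / real N + v)"
        using * BA BB by (auto simp: step_sets_def)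
    qed (use borel in \<open>auto simp: step_sets_borel intro!: Rats_divide\<close>)
    then show ?case by (simp only: eq)
  qed
  from this[of N] have "0 < prob (inc_path 0 1 (\<lambda>v. A \<inter> step_sets 1 B v))" using N by simp
  also have "\<dots> \<le> prob (inc_path 0 1 (\<lambda>_. A))" using borel by (intro inc_path_prob_mono) auto
  finally show ?thesis .
qed

text \<open>For \<open>a \<noteq> 0\<close> the working substitute for lying in the support of the
  Levy measure.\<close>

definition charged :: "real \<Rightarrow> bool" where
  "charged a \<longleftrightarrow> (\<forall>\<eta>>0. \<exists>c>0. \<forall>\<^sub>F N in sequentially. prob (tube (1 / real N) a \<eta>) \<ge> c / real N)"

lemma charged_tube_pos:
  assumes "charged a" "\<eta> > 0" "\<delta> > 0"
  obtains N :: nat where "N > 0" "1 / real N \<le> \<delta>" "prob (tube (1 / real N) a \<eta>) > 0"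
proof -
  obtain c where c: "c > 0" "\<forall>\<^sub>F N in sequentially. prob (tube (1 / real N) a \<eta>) \<ge> c / real N"
    using assms by (auto simp: charged_def)
  obtain m where m: "m > 0" "\<forall>N\<ge>m. 1 / real N < \<delta>" using inverse_nat_eventually_less[OF assms(3)] by blast
  obtain n where n: "\<forall>N\<ge>n. prob (tube (1 / real N) a \<eta>) \<ge> c / real N"
    using c(2) by (auto simp: eventually_sequentially)
  define N where "N = max m n"
  have "N > 0" "1 / real N \<le> \<delta>" using m by (auto simp: N_def less_imp_le)
  moreover have "0 < c / real N" using c(1) \<open>N > 0\<close> by simp
  moreover have "c / real N \<le> prob (tube (1 / real N) a \<eta>)" using n by (simp add: N_def)
  ultimately show thesis using that[of N] by linarith
qed

lemma charged_step:
  assumes "charged a" "\<eta> > 0"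
  shows "\<exists>c>0. \<forall>\<^sub>F N in sequentially. prob (inc_path 0 (1 / real N) (step_sets (1 / real N) (ball a \<eta>))) \<ge> c / real N"
proof -
  obtain c where c: "c > 0" "\<forall>\<^sub>F N in sequentially. prob (tube (1 / real N) a \<eta>) \<ge> c / real N"
    using assms by (auto simp: charged_def)
  have "prob (tube (1 / real N) a \<eta>) \<le> prob (inc_path 0 (1 / real N) (step_sets (1 / real N) (ball a \<eta>)))" for N :: nat
    unfolding tube_def by (intro inc_path_prob_mono) (auto simp: tube_sets_def step_sets_def)
  with c show ?thesis by (intro exI[of _ c]) (auto elim!: eventually_mono intro: order_trans)
qed

text \<open>A tube of width \<open>min r b\<close> around a jump of \<open>- b\<close> never rises
  to \<open>r\<close> and ends below 0, so such blocks can be chained up to time 1.\<close>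

lemma negative_charge_sup_pos:
  assumes b: "b > 0" "charged (- b)" and r: "r > 0"
  shows "prob (inc_path 0 1 (\<lambda>_. {..r})) > 0"
proof -
  have "min r b > 0" using b r by simp
  from charged_tube_pos[OF b(2) this zero_less_one] obtain N :: nat
    where N: "N > 0" "prob (tube (1 / real N) (- b) (min r b)) > 0" by blast
  have "prob (tube (1 / real N) (- b) (min r b)) \<le> prob (inc_path 0 (1 / real N) (\<lambda>v. {..r} \<inter> step_sets (1 / real N) {..0} v))"
    unfolding tube_def using b r
    by (intro inc_path_prob_mono) (auto simp: tube_sets_def step_sets_def dist_real_def)
  then show ?thesis
    using N r by (intro inc_path_iterate_pos[OF N(1), of "{..r}" "{..0}"]) auto
qed

text \<open>
  The time \<open>T\<close> has to depend on \<open>\<eta>\<close>: a support point of the Levy measure is approached only by the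
  increments over shorter and shorter cells.
\<close>

definition reach :: "real \<Rightarrow> real \<Rightarrow> real \<Rightarrow> bool" where
  "reach l \<tau> y \<longleftrightarrow> (\<forall>\<eta>>0. \<exists>T\<in>\<rat>. 0 \<le> T \<and> T \<le> \<tau> \<and> prob (inc_path 0 T (\<lambda>v. {..<l} \<inter> step_sets T (ball y \<eta>) v)) > 0)"

lemma reach_zero:
  assumes "l > 0" "\<tau> \<ge> 0"
  shows "reach l \<tau> 0"
  unfolding reach_def
proof (intro allI impI bexI[of _ 0] conjI)
  fix \<eta> :: real assume "\<eta> > 0"
  then have "inc_path 0 0 (\<lambda>v. {..<l} \<inter> step_sets 0 (ball 0 \<eta>) v) = space P"
    using assms by (auto simp: inc_path_def step_sets_def)
  then show "prob (inc_path 0 0 (\<lambda>v. {..<l} \<inter> step_sets 0 (ball 0 \<eta>) v)) > 0" by (simp add: prob_space)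
qed (use assms in auto)

text \<open>The bound \<open>l\<close> limits the second piece along its whole course, so that it
  stays below \<open>x\<close> when started near \<open>w\<close>.\<close>

lemma reach_add:
  assumes w: "reach x \<tau> w" and l: "w + l < x" and a: "reach l \<delta> a"
  shows "reach x (\<tau> + \<delta>) (w + a)"
  unfolding reach_def
proof (intro allI impI)
  fix \<eta> :: real assume \<eta>: "\<eta> > 0"
  \<comment> \<open>One half of \<open>\<eta>\<close> is for the final error;
    \<open>x - w - l\<close> keeps the joined path below \<open>x\<close>.\<close>
  define \<eta>' where "\<eta>' = min (\<eta> / 2) (x - w - l)"
  have \<eta>': "\<eta>' > 0" "\<eta>' \<le> \<eta> / 2" "\<eta>' \<le> x - w - l" using \<eta> l unfolding \<eta>'_def by linarith+
  obtain S where S: "S \<in> \<rat>" "0 \<le> S" "S \<le> \<tau>" "prob (inc_path 0 S (\<lambda>v. {..<x} \<inter> step_sets S (ball w \<eta>') v)) > 0"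
    using w \<eta>'(1) unfolding reach_def by blast
  have "\<eta> / 2 > 0" using \<eta> by simp
  then obtain T where T: "T \<in> \<rat>" "0 \<le> T" "T \<le> \<delta>" "prob (inc_path 0 T (\<lambda>v. {..<l} \<inter> step_sets T (ball a (\<eta> / 2)) v)) > 0"
    using a unfolding reach_def by blast
  have "prob (inc_path 0 (S + T) (\<lambda>v. {..<x} \<inter> step_sets (S + T) (ball (w + a) \<eta>) v)) > 0"
  proof (rule inc_path_concat_pos[OF S(1,2) T(1,2) _ _ _ S(4) T(4)])
    fix v y assume "0 \<le> v" "v < S" "y \<in> {..<x} \<inter> step_sets S (ball w \<eta>') v"
    then show "y \<in> {..<x} \<inter> step_sets (S + T) (ball (w + a) \<eta>) v"
      using T(2) by (auto simp: step_sets_def)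
  next
    fix v y z assume *: "0 \<le> v" "v \<le> T" "y \<in> {..<x} \<inter> step_sets S (ball w \<eta>') S"
      "z \<in> {..<l} \<inter> step_sets T (ball a (\<eta> / 2)) v"
    have "\<bar>y - w\<bar> < \<eta>'" "z < l" using * by (auto simp: step_sets_def dist_real_def abs_minus_commute)
    moreover have "\<bar>z - a\<bar> < \<eta> / 2" if "v = T"
      using * that by (auto simp: step_sets_def dist_real_def abs_minus_commute)
    ultimately have "y + z < x" "v = T \<Longrightarrow> \<bar>w + a - (y + z)\<bar> < \<eta>"
      using \<eta>' by linarith+
    then show "y + z \<in> {..<x} \<inter> step_sets (S + T) (ball (w + a) \<eta>) (S + v)"
      by (auto simp: step_sets_def dist_real_def)
  qed (auto simp: step_sets_borel)
  then show "\<exists>T\<in>\<rat>. 0 \<le> T \<and> T \<le> \<tau> + \<delta> \<and> prob (inc_path 0 T (\<lambda>v. {..<x} \<inter> step_sets T (ball (w + a) \<eta>) v)) > 0"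
    using S T by (intro bexI[of _ "S + T"]) auto
qed

text \<open>A narrow tube stays close to 0 or \<open>a\<close>, hence below any \<open>l\<close>
  larger than both.\<close>

lemma charged_reach:
  assumes a: "charged a" and l: "max 0 a < l" and \<delta>: "\<delta> > 0"
  shows "reach l \<delta> a"
  unfolding reach_def
proof (intro allI impI)
  fix \<eta> :: real assume "\<eta> > 0"
  then have "min \<eta> (l - max 0 a) > 0" using l by simp
  from charged_tube_pos[OF a this \<delta>] obtain N :: nat
    where N: "N > 0" "1 / real N \<le> \<delta>" "prob (tube (1 / real N) a (min \<eta> (l - max 0 a))) > 0" by blast
  have "prob (tube (1 / real N) a (min \<eta> (l - max 0 a)))
      \<le> prob (inc_path 0 (1 / real N) (\<lambda>v. {..<l} \<inter> step_sets (1 / real N) (ball a \<eta>) v))"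
    unfolding tube_def using l
    by (intro inc_path_prob_mono) (auto simp: tube_sets_def step_sets_def dist_real_def step_sets_borel)
  then show "\<exists>T\<in>\<rat>. 0 \<le> T \<and> T \<le> \<delta> \<and> prob (inc_path 0 T (\<lambda>v. {..<l} \<inter> step_sets T (ball a \<eta>) v)) > 0"
    using N by (intro bexI[of _ "1 / real N"]) auto
qed

text \<open>The strict bound on \<open>\<tau>\<close> leaves time before \<open>1 / 2\<close> for a
  further step or for holding the level.\<close>

definition reachable :: "real \<Rightarrow> real set" where
  "reachable x = {y. y < x \<and> (\<exists>\<tau>. 0 \<le> \<tau> \<and> \<tau> < 1 / 2 \<and> reach x \<tau> y)}"

lemma zero_reachable: "x > 0 \<Longrightarrow> 0 \<in> reachable x"
  unfolding reachable_def using reach_zero[of x 0] by (auto intro!: exI[of _ 0])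

lemma reachable_add:
  assumes w: "w \<in> reachable x" and a: "charged a" "w + a < x"
  shows "w + a \<in> reachable x"
proof -
  obtain \<tau> where \<tau>: "0 \<le> \<tau>" "\<tau> < 1 / 2" "reach x \<tau> w" "w < x" using w by (auto simp: reachable_def)
  \<comment> \<open>The midpoint between \<open>max 0 a\<close> and \<open>x - w\<close>, which
    gives both strict inequalities.\<close>
  define l where "l = (max 0 a + (x - w)) / 2"
  have l: "max 0 a < l" "w + l < x" using \<tau>(4) a(2) by (auto simp: l_def max_def field_simps)
  define \<delta> where "\<delta> = (1 / 2 - \<tau>) / 2"
  have \<delta>: "\<delta> > 0" "\<tau> + \<delta> < 1 / 2" using \<tau>(2) by (simp_all add: \<delta>_def field_simps)
  have "reach x (\<tau> + \<delta>) (w + a)" using reach_add[OF \<tau>(3) l(2) charged_reach[OF a(1) l(1) \<delta>(1)]] .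
  then show ?thesis unfolding reachable_def using a(2) \<tau>(1) \<delta> by (auto intro!: exI[of _ "\<tau> + \<delta>"])
qed

text \<open>The window is open, so the inequalities at \<open>y\<close> survive small errors, and
  small noise holds the level for some time after \<open>y\<close> is reached.\<close>

lemma reachable_in_window_liminf_pos:
  assumes a: "a > 0" "charged a" and b: "b > 0" "charged (- b)"
    and y: "y \<in> reachable x" "x - a < y" "y < x - a + b"
  shows "liminf (\<lambda>n. ereal (real n * missed_exceedance_prob P X x n)) > 0"
proof -
  obtain \<tau> where \<tau>: "0 \<le> \<tau>" "\<tau> < 1 / 2" "reach x \<tau> y" "y < x" using y(1) by (auto simp: reachable_def)
  \<comment> \<open>A quarter of the slack covers the errors of level, up-step and down-step
    together with the later climb.\<close>
  define \<eta> where "\<eta> = min (min (y + a - x) (x - (y + a - b))) (x - y) / 4"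
  have \<eta>: "\<eta> > 0" "4 * \<eta> \<le> y + a - x" "4 * \<eta> \<le> x - (y + a - b)" "4 * \<eta> \<le> x - y"
    using y \<tau>(4) unfolding \<eta>_def by auto
  have "\<eta> / 2 > 0" using \<eta>(1) by simp
  obtain S where S: "S \<in> \<rat>" "0 \<le> S" "S \<le> \<tau>" "prob (inc_path 0 S (\<lambda>v. {..<x} \<inter> step_sets S (ball y (\<eta> / 2)) v)) > 0"
    using \<tau>(3) \<open>\<eta> / 2 > 0\<close> unfolding reach_def by blast
  have "1 / 2 - \<tau> > 0" using \<tau> by simp
  obtain T where T: "T \<in> \<rat>" "0 < T" "T < 1 / 2 - \<tau>" "prob (inc_path 0 T (\<lambda>_. ball 0 (\<eta> / 2))) > 0"
    using small_noise[OF \<open>\<eta> / 2 > 0\<close> \<open>1 / 2 - \<tau> > 0\<close>] by blast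
  have pre: "prob (inc_path 0 (S + T) (\<lambda>v. {..x} \<inter> (if S \<le> v then ball y \<eta> else UNIV))) > 0"
  proof (rule inc_path_concat_pos[OF S(1,2) T(1) _ _ _ _ S(4) T(4)])
    fix v y' z :: real assume "y' \<in> {..<x} \<inter> step_sets S (ball y (\<eta> / 2)) S" "z \<in> ball 0 (\<eta> / 2)" "0 \<le> v"
    then have "\<bar>y' - y\<bar> < \<eta> / 2" "\<bar>z\<bar> < \<eta> / 2"
      by (auto simp: step_sets_def dist_real_def abs_minus_commute)
    then have "y' + z \<le> x" "\<bar>y - (y' + z)\<bar> < \<eta>" using \<eta> by linarith+
    then show "y' + z \<in> {..x} \<inter> (if S \<le> S + v then ball y \<eta> else UNIV)"
      by (auto simp: dist_real_def)
  qed (use T in \<open>auto simp: step_sets_borel\<close>)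
  obtain c1 where c1: "c1 > 0" "\<forall>\<^sub>F N in sequentially. prob (inc_path 0 (1 / real N) (step_sets (1 / real N) (ball a \<eta>))) \<ge> c1 / real N"
    using charged_step[OF a(2) \<eta>(1)] by blast
  obtain c2 where c2: "c2 > 0" "\<forall>\<^sub>F N in sequentially. prob (inc_path 0 (1 / real N) (step_sets (1 / real N) (ball (- b) \<eta>))) \<ge> c2 / real N"
    using charged_step[OF b(2) \<eta>(1)] by blast
  have "S + T \<in> \<rat>" "S < S + T" "S + T \<le> 1 / 2" using S T by auto
  then show ?thesis
  proof (rule missed_exceedance_liminf_pos[OF _ S(2) _ _ _ _ _ pre c1 c2 negative_charge_sup_pos[OF b \<eta>(1)]])
    fix y' u d assume "y' \<in> ball y \<eta>" "u \<in> ball a \<eta>" "d \<in> ball (- b) \<eta>"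
    then have "\<bar>y' - y\<bar> < \<eta>" "\<bar>u - a\<bar> < \<eta>" "\<bar>d + b\<bar> < \<eta>"
      by (auto simp: dist_real_def)
    then show "x < y' + u \<and> y' + u + d \<le> x - \<eta>" using \<eta> by linarith
  qed auto
qed

section \<open>Exact steps when the reachable levels are isolated\<close>

definition exact_sets :: "real \<Rightarrow> real \<Rightarrow> real \<Rightarrow> real set" where
  "exact_sets T a v = {0, a} \<inter> step_sets T {a} v"

lemma exact_sets_borel: "exact_sets T a v \<in> sets borel"
  by (auto simp: exact_sets_def step_sets_borel)

text \<open>A further value \<open>a'\<close> of the tube path would make \<open>w + a'\<close>
  reachable, although it is close to \<open>w\<close> or to \<open>w + a\<close>. Isolation
  therefore leaves only the increments 0 and \<open>a\<close>, up to a null event.\<close>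

lemma tube_exact:
  assumes iso: "\<And>z. \<exists>\<eta>>0. \<forall>y\<in>reachable x. \<bar>y - z\<bar> < \<eta> \<longrightarrow> y = z"
    and w: "w \<in> reachable x" "w + a < x"
  shows "\<exists>\<eta>>0. \<exists>\<tau>0>0. \<forall>T\<in>\<rat>. 0 \<le> T \<longrightarrow> T \<le> \<tau>0 \<longrightarrow>
    prob (tube T a \<eta>) \<le> prob (inc_path 0 T (exact_sets T a))"
proof -
  obtain \<tau> where \<tau>: "0 \<le> \<tau>" "\<tau> < 1 / 2" "reach x \<tau> w" "w < x" using w(1) by (auto simp: reachable_def)
  define l where "l = (max 0 a + (x - w)) / 2"
  have l: "max 0 a < l" "w + l < x" using \<tau>(4) w(2) by (auto simp: l_def max_def field_simps)
  define \<tau>0 where "\<tau>0 = (1 / 2 - \<tau>) / 2"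
  have \<tau>0: "\<tau>0 > 0" "\<tau> + \<tau>0 < 1 / 2" using \<tau>(2) by (simp_all add: \<tau>0_def field_simps)
  obtain \<eta>1 where \<eta>1: "\<eta>1 > 0" "\<And>y. y \<in> reachable x \<Longrightarrow> \<bar>y - w\<bar> < \<eta>1 \<Longrightarrow> y = w" using iso by blast
  obtain \<eta>2 where \<eta>2: "\<eta>2 > 0" "\<And>y. y \<in> reachable x \<Longrightarrow> \<bar>y - (w + a)\<bar> < \<eta>2 \<Longrightarrow> y = w + a" using iso by blast
  \<comment> \<open>\<open>\<eta>1\<close> and \<open>\<eta>2\<close> serve isolation,
    \<open>l - max 0 a\<close> keeps the tube below \<open>l\<close>, and the absolute value of
    \<open>a\<close> separates 0 from \<open>a\<close> at the end time. For \<open>a = 0\<close>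
    there is nothing to separate, hence the default 1.\<close>
  define \<eta> where "\<eta> = min (min \<eta>1 \<eta>2) (min (l - max 0 a) (if a = 0 then 1 else \<bar>a\<bar>))"
  have \<eta>: "\<eta> > 0" "\<eta> \<le> \<eta>1" "\<eta> \<le> \<eta>2" "\<eta> \<le> l - max 0 a" "a \<noteq> 0 \<Longrightarrow> \<eta> \<le> \<bar>a\<bar>"
    using \<eta>1(1) \<eta>2(1) l(1) by (auto simp: \<eta>_def)
  have "prob (tube T a \<eta>) \<le> prob (inc_path 0 T (exact_sets T a))" if T: "T \<in> \<rat>" "0 \<le> T" "T \<le> \<tau>0" for T
  proof -
    have "AE \<omega> in P. \<omega> \<in> tube T a \<eta> \<longrightarrow> X v \<omega> - X 0 \<omega> \<in> {0, a}" if v: "v \<in> \<rat> \<inter> {0..T}" for v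
    proof -
      \<comment> \<open>The value of the path as a set, empty off the tube, so that the covering
        lemma excludes all wrong values at once.\<close>
      define S where "S \<omega> = (if \<omega> \<in> tube T a \<eta> then {X v \<omega> - X 0 \<omega>} else {})" for \<omega>
      have "AE \<omega> in P. S \<omega> \<inter> ((ball 0 \<eta> \<union> ball a \<eta>) - {0, a}) = {}"
      proof (rule AE_disjoint_of_local, rule ccontr)
        fix a' assume a': "a' \<in> (ball 0 \<eta> \<union> ball a \<eta>) - {0, a}"
          and neg: "\<not> (\<exists>r>0. AE \<omega> in P. S \<omega> \<inter> ball a' r = {})"
        \<comment> \<open>Appending the tube to a path ending near \<open>w\<close> would reach \<open>w + a'\<close>, contradicting isolation.\<close>
        have "reach l \<tau>0 a'"
          unfolding reach_def
        proof (intro allI impI bexI[of _ v] conjI)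
          fix r :: real assume "r > 0"
          define Z where "Z = tube T a \<eta> \<inter> inc_path 0 v (step_sets v (ball a' r))"
          have Z: "Z \<in> sets P" unfolding Z_def
            by (intro sets.Int tube_events inc_path_sets) (auto simp: step_sets_borel)
          have sub: "S \<omega> \<inter> ball a' r = {}" if "\<omega> \<notin> Z" for \<omega>
            using that unfolding Z_def S_def tube_def by (auto simp: inc_path_def mem_step_sets)
          have "\<not> (AE \<omega> in P. \<omega> \<notin> Z)"
          proof
            assume "AE \<omega> in P. \<omega> \<notin> Z"
            then have "AE \<omega> in P. S \<omega> \<inter> ball a' r = {}" by eventually_elim (rule sub)
            with neg \<open>r > 0\<close> show False by blast
          qed
          then have "prob Z > 0" using Z by (rule prob_pos_of_not_AE[rotated])
          also have "prob Z \<le> prob (inc_path 0 v (\<lambda>u. {..<l} \<inter> step_sets v (ball a' r) u))"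
          proof (intro finite_measure_mono inc_path_sets)
            show "Z \<subseteq> inc_path 0 v (\<lambda>u. {..<l} \<inter> step_sets v (ball a' r) u)"
            proof
              fix \<omega> assume \<omega>: "\<omega> \<in> Z"
              have "X u \<omega> - X 0 \<omega> < l" if "u \<in> \<rat> \<inter> {0..v}" for u
              proof -
                have "u \<in> \<rat> \<inter> {0..T}" using that v by auto
                then have "X (0 + u) \<omega> - X 0 \<omega> \<in> ball 0 \<eta> \<union> ball a \<eta>"
                  using \<omega> unfolding Z_def tube_def inc_path_def tube_sets_def by blast
                then show ?thesis using \<eta>(4) by (auto simp: dist_real_def)
              qed
              then show "\<omega> \<in> inc_path 0 v (\<lambda>u. {..<l} \<inter> step_sets v (ball a' r) u)"
                using \<omega> unfolding Z_def inc_path_def by auto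
            qed
          qed (auto simp: step_sets_borel)
          finally show "0 < prob (inc_path 0 v (\<lambda>u. {..<l} \<inter> step_sets v (ball a' r) u))" .
        qed (use v T in auto)
        then have "reach x (\<tau> + \<tau>0) (w + a')" using reach_add[OF \<tau>(3) l(2)] by blast
        moreover have "w + a' < x" using a' \<eta>(4) l(2) by (auto simp: dist_real_def)
        ultimately have R: "w + a' \<in> reachable x"
          unfolding reachable_def using \<tau>(1) \<tau>0 by (auto intro!: exI[of _ "\<tau> + \<tau>0"])
        have "\<bar>(w + a') - w\<bar> < \<eta>1 \<or> \<bar>(w + a') - (w + a)\<bar> < \<eta>2"
          using a' \<eta>(2,3) by (auto simp: dist_real_def)
        then show False using \<eta>1(2)[OF R] \<eta>2(2)[OF R] a' by auto
      qed
      then show ?thesis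
        using AE_space
      proof eventually_elim
        case (elim \<omega>)
        show ?case
        proof
          assume \<omega>: "\<omega> \<in> tube T a \<eta>"
          then have "X (0 + v) \<omega> - X 0 \<omega> \<in> ball 0 \<eta> \<union> ball a \<eta>"
            using v unfolding tube_def inc_path_def tube_sets_def by blast
          then show "X v \<omega> - X 0 \<omega> \<in> {0, a}" using elim(1) \<omega> by (auto simp: S_def simp del: mem_ball)
        qed
      qed
    qed
    then have "AE \<omega> in P. \<forall>v\<in>\<rat> \<inter> {0..T}. \<omega> \<in> tube T a \<eta> \<longrightarrow> X v \<omega> - X 0 \<omega> \<in> {0, a}"
      by (subst AE_ball_countable) (auto intro: countable_rat countable_subset[OF Int_lower1])
    then have "AE \<omega> in P. \<omega> \<in> tube T a \<eta> \<longrightarrow> \<omega> \<in> inc_path 0 T (exact_sets T a)"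
    proof eventually_elim
      case (elim \<omega>)
      show ?case
      proof
        assume \<omega>: "\<omega> \<in> tube T a \<eta>"
        have "X (0 + T) \<omega> - X 0 \<omega> \<in> tube_sets T a \<eta> T"
          using \<omega> T unfolding tube_def inc_path_def by auto
        then have "X T \<omega> - X 0 \<omega> \<in> ball a \<eta>" by (simp add: tube_sets_def)
        moreover have "X T \<omega> - X 0 \<omega> \<in> {0, a}" using elim \<omega> T by auto
        ultimately have "X T \<omega> - X 0 \<omega> = a" using \<eta>(5) by (cases "a = 0") (auto simp: dist_real_def)
        then show "\<omega> \<in> inc_path 0 T (exact_sets T a)"
          using elim \<omega> unfolding inc_path_def exact_sets_def step_sets_def tube_def by auto
      qed
    qed
    then show ?thesis by (intro finite_measure_mono_AE inc_path_sets) (auto simp: exact_sets_borel)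
  qed
  then show ?thesis using \<eta>(1) \<tau>0(1) by blast
qed

lemma charged_exact:
  assumes iso: "\<And>z. \<exists>\<eta>>0. \<forall>y\<in>reachable x. \<bar>y - z\<bar> < \<eta> \<longrightarrow> y = z"
    and w: "w \<in> reachable x" "w + a < x" and a: "charged a"
  obtains c where "c > 0" "\<forall>\<^sub>F N in sequentially. prob (inc_path 0 (1 / real N) (exact_sets (1 / real N) a)) \<ge> c / real N"
proof -
  obtain \<eta> \<tau>0 where *: "\<eta> > 0" "\<tau>0 > 0"
    "\<And>T. T \<in> \<rat> \<Longrightarrow> 0 \<le> T \<Longrightarrow> T \<le> \<tau>0 \<Longrightarrow> prob (tube T a \<eta>) \<le> prob (inc_path 0 T (exact_sets T a))"
    using tube_exact[OF iso w] by blast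
  obtain c where c: "c > 0" "\<forall>\<^sub>F N in sequentially. prob (tube (1 / real N) a \<eta>) \<ge> c / real N"
    using a *(1) by (auto simp: charged_def)
  obtain m where m: "m > 0" "\<forall>N\<ge>m. 1 / real N < \<tau>0" using inverse_nat_eventually_less[OF *(2)] by blast
  have "\<forall>\<^sub>F N in sequentially. prob (inc_path 0 (1 / real N) (exact_sets (1 / real N) a)) \<ge> c / real N"
    using c(2) eventually_ge_at_top[of m]
  proof eventually_elim
    case (elim N)
    have "prob (tube (1 / real N) a \<eta>) \<le> prob (inc_path 0 (1 / real N) (exact_sets (1 / real N) a))"
      using m(2) elim(2) by (intro *(3)) (auto intro: less_imp_le)
    with elim(1) show ?case by linarith
  qed
  with c(1) show thesis by (rule that)
qed

text \<open>For \<open>a = 0\<close> the tube is small noise, which has positive probability on a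
  short interval and is then almost surely constant; constant blocks are chained up to time
  1.\<close>

lemma isolated_stays_zero:
  assumes iso: "\<And>z. \<exists>\<eta>>0. \<forall>y\<in>reachable x. \<bar>y - z\<bar> < \<eta> \<longrightarrow> y = z" and x: "x > 0"
  shows "prob (inc_path 0 1 (\<lambda>_. {0})) > 0"
proof -
  obtain \<eta> \<tau>0 where *: "\<eta> > 0" "\<tau>0 > 0"
    "\<And>T. T \<in> \<rat> \<Longrightarrow> 0 \<le> T \<Longrightarrow> T \<le> \<tau>0 \<Longrightarrow> prob (tube T 0 \<eta>) \<le> prob (inc_path 0 T (exact_sets T 0))"
    using tube_exact[OF iso zero_reachable[OF x], of 0] x by auto
  obtain T where T: "T \<in> \<rat>" "0 < T" "T < \<tau>0" "prob (inc_path 0 T (\<lambda>_. ball 0 \<eta>)) > 0"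
    using small_noise[OF *(1,2)] by blast
  have "tube T 0 \<eta> = inc_path 0 T (\<lambda>_. ball 0 \<eta>)" unfolding tube_def inc_path_def tube_sets_def by auto
  then have "prob (inc_path 0 T (exact_sets T 0)) > 0" using *(3)[of T] T by simp
  obtain N :: nat where N: "N > 0" "1 / real N < T" using inverse_nat_eventually_less[OF T(2)] by blast
  have "prob (inc_path 0 T (exact_sets T 0)) \<le> prob (inc_path 0 (1 / real N) (\<lambda>v. {0} \<inter> step_sets (1 / real N) {0} v))"
    using N by (intro inc_path_prob_mono) (auto simp: exact_sets_def step_sets_def)
  then show ?thesis
    using \<open>prob (inc_path 0 T (exact_sets T 0)) > 0\<close> N by (intro inc_path_iterate_pos[OF N(1), of "{0}" "{0}"]) auto
qed

text \<open>Unlike in \<open>reachable\<close>, the end level is hit exactly and the boundary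
  \<open>x\<close> may be touched, which is harmless without errors.\<close>

definition exactly_reachable :: "real \<Rightarrow> real set" where
  "exactly_reachable x =
    {y. y \<le> x \<and> (\<exists>\<tau>\<in>\<rat>. 0 \<le> \<tau> \<and> \<tau> < 1 / 2 \<and> prob (inc_path 0 \<tau> (\<lambda>v. {..x} \<inter> step_sets \<tau> {y} v)) > 0)}"

lemma exactly_reachable_add:
  assumes w: "w \<in> exactly_reachable x" "w + a \<le> x"
    and c: "c > 0" "\<forall>\<^sub>F N in sequentially. prob (inc_path 0 (1 / real N) (exact_sets (1 / real N) a)) \<ge> c / real N"
  shows "w + a \<in> exactly_reachable x"
proof -
  obtain \<tau> where \<tau>: "\<tau> \<in> \<rat>" "0 \<le> \<tau>" "\<tau> < 1 / 2" "prob (inc_path 0 \<tau> (\<lambda>v. {..x} \<inter> step_sets \<tau> {w} v)) > 0" "w \<le> x"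
    using w(1) by (auto simp: exactly_reachable_def)
  have "1 / 2 - \<tau> > 0" using \<tau> by simp
  from inverse_nat_eventually_less[OF this]
  obtain m where m: "m > 0" "\<forall>N\<ge>m. 1 / real N < 1 / 2 - \<tau>" by blast
  obtain N where N: "N \<ge> m" "prob (inc_path 0 (1 / real N) (exact_sets (1 / real N) a)) \<ge> c / real N"
    using c(2) unfolding eventually_sequentially by (meson linear)
  have "N > 0" "1 / real N < 1 / 2 - \<tau>" using m N(1) by auto
  then have "0 < c / real N" using c(1) by simp
  then have pos: "prob (inc_path 0 (1 / real N) (exact_sets (1 / real N) a)) > 0" using N(2) by linarith
  have "prob (inc_path 0 (\<tau> + 1 / real N) (\<lambda>v. {..x} \<inter> step_sets (\<tau> + 1 / real N) {w + a} v)) > 0"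
  proof (rule inc_path_concat_pos[OF \<tau>(1,2) _ _ _ _ _ \<tau>(4) pos])
    fix v y z assume *: "y \<in> {..x} \<inter> step_sets \<tau> {w} \<tau>" "z \<in> exact_sets (1 / real N) a v"
    then have "y = w" "z \<in> {0, a}" "v = 1 / real N \<Longrightarrow> z = a" by (auto simp: step_sets_def exact_sets_def)
    then show "y + z \<in> {..x} \<inter> step_sets (\<tau> + 1 / real N) {w + a} (\<tau> + v)"
      using w(2) \<tau>(5) by (auto simp: step_sets_def)
  next
    fix v y assume "v < \<tau>" "y \<in> {..x} \<inter> step_sets \<tau> {w} v"
    moreover have "1 / real N > 0" using \<open>N > 0\<close> by simp
    ultimately have "v \<noteq> \<tau> + 1 / real N" "y \<le> x" by auto
    then show "y \<in> {..x} \<inter> step_sets (\<tau> + 1 / real N) {w + a} v" by (simp add: step_sets_def)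
  qed (auto simp: step_sets_borel exact_sets_borel)
  moreover have "\<tau> + 1 / real N \<in> \<rat>" "0 \<le> \<tau> + 1 / real N" "\<tau> + 1 / real N < 1 / 2"
    using \<tau> \<open>1 / real N < 1 / 2 - \<tau>\<close> by (auto intro!: Rats_add Rats_divide)
  ultimately show ?thesis using w(2) unfolding exactly_reachable_def by blast
qed

text \<open>With exact steps and exact holding of a level, the crossing sets can be singletons and
  the later climb can be 0, so the non-strict window of \<open>walk_reaches_window\<close>
  suffices.\<close>

lemma isolated_liminf_pos:
  assumes iso: "\<And>z. \<exists>\<eta>>0. \<forall>y\<in>reachable x. \<bar>y - z\<bar> < \<eta> \<longrightarrow> y = z" and x: "x > 0"
    and a: "a > 0" "charged a" and b: "b > 0" "charged (- b)"
  shows "liminf (\<lambda>n. ereal (real n * missed_exceedance_prob P X x n)) > 0"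
proof -
  \<comment> \<open>Exactness of the up-step requires a reachable level with room for
    \<open>a\<close> below \<open>x\<close>; \<open>q\<close> down-steps from 0 provide one.\<close>
  obtain q :: nat where q: "a \<le> real q * b" using ex_nat_mult_ge[OF b(1)] by blast
  have w: "0 + real q * (- b) \<in> reachable x"
  proof (rule closed_walk_nat[where n = q])
    fix j assume R: "0 + real j * (- b) \<in> reachable x"
    then have "0 + real j * (- b) + - b < x" using b(1) by (auto simp: reachable_def)
    from reachable_add[OF R b(2) this] show "0 + real (Suc j) * (- b) \<in> reachable x"
      by (simp add: algebra_simps)
  qed (use zero_reachable[OF x] in auto)
  have "0 + real q * (- b) + a < x" using q x by simp
  from charged_exact[OF iso w this a(2)] obtain c1
    where c1: "c1 > 0" "\<forall>\<^sub>F N in sequentially. prob (inc_path 0 (1 / real N) (exact_sets (1 / real N) a)) \<ge> c1 / real N" by blast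
  have "0 + - b < x" using b x by simp
  from charged_exact[OF iso zero_reachable[OF x] this b(2)] obtain c2
    where c2: "c2 > 0" "\<forall>\<^sub>F N in sequentially. prob (inc_path 0 (1 / real N) (exact_sets (1 / real N) (- b))) \<ge> c2 / real N" by blast
  note zero = isolated_stays_zero[OF iso x]
  have "0 \<in> exactly_reachable x"
  proof -
    have "inc_path 0 0 (\<lambda>v. {..x} \<inter> step_sets 0 {0} v) = space P"
      using x by (auto simp: inc_path_def step_sets_def)
    then show ?thesis using x unfolding exactly_reachable_def by (auto simp: prob_space intro!: bexI[of _ 0])
  qed
  moreover have "y \<le> x" if "y \<in> exactly_reachable x" for y using that by (simp add: exactly_reachable_def)
  moreover have "y + a \<in> exactly_reachable x" if "y \<in> exactly_reachable x" "y + a \<le> x" for y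
    using exactly_reachable_add[OF that c1] .
  moreover have "y - b \<in> exactly_reachable x" if "y \<in> exactly_reachable x" for y
  proof -
    have "y + - b \<le> x" using that b(1) by (auto simp: exactly_reachable_def)
    from exactly_reachable_add[OF that this c2] show ?thesis by simp
  qed
  ultimately obtain y where y: "y \<in> exactly_reachable x" "y + a > x" "y + a - b \<le> x"
    using walk_reaches_window[OF a(1) b(1) less_imp_le[OF x], of "exactly_reachable x"] by blast
  obtain \<tau> where \<tau>: "\<tau> \<in> \<rat>" "0 \<le> \<tau>" "\<tau> < 1 / 2" "prob (inc_path 0 \<tau> (\<lambda>v. {..x} \<inter> step_sets \<tau> {y} v)) > 0" "y \<le> x"
    using y(1) by (auto simp: exactly_reachable_def)
  \<comment> \<open>The level \<open>y\<close> is held from \<open>\<tau>\<close> to time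
    \<open>1 / 2\<close>.\<close>
  define T where "T = 1 / 2 - \<tau>"
  have T: "T \<in> \<rat>" "0 < T" "T \<le> 1" using \<tau> by (auto simp: T_def intro!: Rats_diff Rats_divide)
  have "prob (inc_path 0 1 (\<lambda>_. {0})) \<le> prob (inc_path 0 T (\<lambda>_. {0}))"
    using T by (intro inc_path_prob_mono) auto
  then have zero_T: "prob (inc_path 0 T (\<lambda>_. {0})) > 0" using zero by linarith
  have pre: "prob (inc_path 0 (\<tau> + T) (\<lambda>v. {..x} \<inter> (if \<tau> \<le> v then {y} else UNIV))) > 0"
    by (rule inc_path_concat_pos[OF \<tau>(1,2) T(1) _ _ _ _ \<tau>(4) zero_T])
      (use T \<tau>(5) in \<open>auto simp: step_sets_borel step_sets_def split: if_splits\<close>)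
  have up: "\<forall>\<^sub>F N in sequentially. prob (inc_path 0 (1 / real N) (step_sets (1 / real N) {a'})) \<ge> c / real N"
    if "\<forall>\<^sub>F N in sequentially. prob (inc_path 0 (1 / real N) (exact_sets (1 / real N) a')) \<ge> c / real N" for a' c
    using that
  proof eventually_elim
    case (elim N)
    have "prob (inc_path 0 (1 / real N) (exact_sets (1 / real N) a')) \<le> prob (inc_path 0 (1 / real N) (step_sets (1 / real N) {a'}))"
      by (intro inc_path_prob_mono) (auto simp: exact_sets_def step_sets_borel)
    with elim show ?case by linarith
  qed
  have "prob (inc_path 0 1 (\<lambda>_. {0})) \<le> prob (inc_path 0 1 (\<lambda>_. {..0}))"
    by (intro inc_path_prob_mono) auto
  then have post: "prob (inc_path 0 1 (\<lambda>_. {..0})) > 0" using zero by linarith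
  have "\<tau> + T \<in> \<rat>" "\<tau> < \<tau> + T" "\<tau> + T \<le> 1 / 2" using \<tau> T by (auto simp: T_def)
  then show ?thesis
    by (rule missed_exceedance_liminf_pos[OF _ \<tau>(2) _ _ _ _ _ pre c1(1) up[OF c1(2)] c2(1) up[OF c2(2)] post])
      (use y in auto)
qed

text \<open>Either some reachable level lies in the open window, or avoiding the window forces all
  reachable levels to be isolated.\<close>

lemma charged_liminf_pos:
  assumes x: "x > 0" and a: "a > 0" "charged a" and b: "b > 0" "charged (- b)"
  shows "liminf (\<lambda>n. ereal (real n * missed_exceedance_prob P X x n)) > 0"
proof (cases "\<exists>y\<in>reachable x. x - a < y \<and> y < x - a + b")
  case True
  then show ?thesis using reachable_in_window_liminf_pos[OF a b] by blast
next
  case False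
  have "\<exists>\<eta>>0. \<forall>y\<in>reachable x. \<bar>y - z\<bar> < \<eta> \<longrightarrow> y = z" for z
  proof (rule walk_avoiding_window_isolated[OF a(1) b(1)])
    fix y assume y: "y \<in> reachable x"
    then show "y < x" by (simp add: reachable_def)
    then have "y + - b < x" using b(1) by simp
    from reachable_add[OF y b(2) this] show "y - b \<in> reachable x" by simp
    show "y + a \<in> reachable x" if "y + a < x" using reachable_add[OF y a(2) that] .
    show "\<not> (x - a < y \<and> y < x - a + b)" using False y by blast
  qed
  then show ?thesis using isolated_liminf_pos[OF _ x a b] by blast
qed

end

theorem lemma10:
  fixes P :: "'a measure" and X :: "real \<Rightarrow> 'a \<Rightarrow> real" and x :: real
  assumes "levy_process P X"
    and "levy_measure P X {0<..} > 0"
    and "levy_measure P X {..<0} > 0"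
    and "x > 0"
  shows "liminf (\<lambda>n. ereal (real n * missed_exceedance_prob P X x n)) > 0"
proof -
  interpret levy_process P X by fact
  obtain a where a: "a > 0" "charged a"
    using levy_measure_charged[OF assms(2)] unfolding charged_def by auto
  obtain b where b: "b < 0" "charged b"
    using levy_measure_charged[OF assms(3)] unfolding charged_def by auto
  show ?thesis using charged_liminf_pos[OF assms(4) a, of "- b"] b by simp
qed

end
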